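(* Consider a partial differential equation of the form $$z_{2t}=A(z,z_1,z_2)\,z_3+B(z,z_1,z_2),\qquad A^2+B^2\neq 0. \qquad (E)$$ Then (E) describes pseudospherical surfaces ($\delta=1$) or spherical surfaces ($\delta=-1$), with corresponding functions $f_{ij}=f_{ij}(z,z_1,\dots,z_k)$ such that $f_{11}=\eta$ is constant, $f_{21}$ and $f_{31}$ are linear non-homogeneous functions of $z$ and $z_2$ with constant coefficients, and $(f_{31,z_2})^2-\delta (f_{21,z_2})^2=0$, if and only if (up to linear coordinate transformations $x\mapsto ax,\ t\mapsto bt,\ z\mapsto cz+c_0$, $abc\neq0$) it can be written in one of the following two forms (with upper and lower signs chosen consistently in each form): **(I)** $$z_{2t}=D_x\psi+a\,\psi+b\,z_2\pm n(1-a)\alpha$$ with $\delta=1$ and associated 1-forms $$\omega_1=\mp a\,dx+\big[(1-a)(mz_1+n)\pm b\big]dt,$$ $$\omega_2=(z_2+\alpha)\,dx+\Big[\psi\mp(1-a)\Big(\frac m2z_1^2+n z_1\Big)-\alpha b\Big]dt,$$ $$\omega_3=\pm\,\omega_2-(1-a)m\,dt,$$ where $\psi=\psi(z,z_1,z_2)$ is a real differentiable function, whereas $a,b\in\{0,1\}$ and $\alpha,m,n\in\mathbb{R}$ are such that $(a-1)\alpha m=0$, $(a-1)b=0$ and, in addition, $a\psi+bz_2+m^2+n^2\neq0$; **(II)** $$z_{2t}=\mp D_x^3h-D_x\big((z_2+m)h\big)-z_2\,D_xh$$ with $\delta=1$ and associated 1-forms $$\omega_1=\eta\,dx+(\mp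 D_xh-\eta h)\,dt,$$ $$\omega_2=\Big(\frac{z_2}{\alpha\mp\beta}+\beta\Big)dx+\Big(\frac{\mp D_x^2h-\eta D_xh}{\alpha\mp\beta}-\Big(\frac{z_2}{\alpha\mp\beta}+\beta\Big)h\Big)dt,$$ $$\omega_3=\Big(\pm\frac{z_2}{\alpha\mp\beta}+\alpha\Big)dx+\Big(\frac{-D_x^2h\mp\eta D_xh}{\alpha\mp\beta}\mp\Big(\frac{z_2}{\alpha\mp\beta}\pm\alpha\Big)h\Big)dt,$$ where $\alpha,\beta,\eta\in\mathbb{R}$, $\alpha\mp\beta\neq0$, $m:=\pm(\alpha^2-\beta^2-\eta^2)$ and $h=h(z)$ is a real differentiable function with $h'\neq0$.
   Context: Notation: $z=z(x,t)$ is a real function; $z_i=\partial_x^i z$ ($z_0=z$), $z_{2t}=\partial_t z_2$. $D_x$, $D_t$ are the total derivatives with respect to $x$ and $t$; on a function $F(z,z_1,\dots,z_m)$, $D_xF=\sum_i z_{i+1}F_{,z_i}$. A subscript $,z$ or $,z_i$ denotes a partial derivative. All functions are differentiable as many times as needed. Inequalities "$\neq0$" for functions are understood generically (on a nonempty open set). Definition. Let $\delta\in\{1,-1\}$. A differential equation $\mathcal{E}$ for $z(x,t)$ describes pseudospherical surfaces (pss) if $\delta=1$, or spherical surfaces (ss) if $\delta=-1$, with corresponding functions $f_{ij}$ ($1\le i\le3$, $1\le j\le2$), if $\mathcal{E}$ is equivalent to (i.e. $z$ solves $\mathcal{E}$ if and only if the following hold) the structure equations $$d\omega_1=\omega_3\wedge\omega_2,\quad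 d\omega_2=\omega_1\wedge\omega_3,\quad d\omega_3=\delta\,\omega_1\wedge\omega_2$$ of a surface with Gaussian curvature $K=-\delta$, where $\omega_i=f_{i1}dx+f_{i2}dt$ (the associated 1-forms), and $\omega_1\wedge\omega_2\neq0$, i.e. $f_{11}f_{22}-f_{12}f_{21}\neq0$. Here $f_{ij}$ are functions of $z$ and finitely many of its $x$-derivatives. Convention on transformations. The class of equations considered and the conditions on the $f_{i1}$ are invariant under linear coordinate transformations $x\mapsto ax$, $t\mapsto bt$, $z\mapsto cz+c_0$ with $a,b,c,c_0\in\mathbb{R}$, $abc\neq0$ (acting on $A$, $B$ and the 1-forms accordingly). The classification is given only up to such transformations. (The constants $a,b$ in form (I) are unrelated to those of the transformations.)
   Formalization: The listed 1-forms are claimed as associated only when ω1∧ω2≠0, since form (I) with a=b=1, ψ=-z_2, m²+n²≠0 meets the printed conditions but has ω1∧ω2=0; A, B are smooth on an open convex domain, and equivalence with the structure equations is read pointwise. *)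

theory Defs
  imports "HOL-Analysis.Analysis"
begin

section \<open>Functions of z and its x-derivatives\<close>

text \<open>
  A jet \<open>u\<close> lists the values \<open>u i\<close> of the derivatives \<open>z\<^sub>i\<close>. A function of \<open>z, z\<^sub>1, \<dots>, z\<^sub>k\<close> is a
  function of jets that ignores the coordinates beyond \<open>k\<close>, so that functions of different
  orders live in one type. The topology on jets is the product topology.
\<close>

type_synonym jet = "nat \<Rightarrow> real"

text \<open>The jets over a domain \<open>U\<close> for \<open>(z, z\<^sub>1, z\<^sub>2)\<close>; all higher derivatives are unrestricted.\<close>

definition jets_over :: "(real \<times> real \<times> real) set \<Rightarrow> jet set" where
  "jets_over U = {u. (u 0, u 1, u 2) \<in> U}"

definition pd :: "nat \<Rightarrow> (jet \<Rightarrow> real) \<Rightarrow> jet \<Rightarrow> real" where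
  "pd i F u = deriv (\<lambda>s. F (u(i := s))) (u i)"

fun Ck_on :: "nat \<Rightarrow> jet set \<Rightarrow> (jet \<Rightarrow> real) \<Rightarrow> bool" where
  "Ck_on 0 S F = continuous_on S F"
| "Ck_on (Suc n) S F =
    (continuous_on S F \<and>
     (\<forall>i. (\<forall>u\<in>S. (\<lambda>s. F (u(i := s))) differentiable (at (u i))) \<and> Ck_on n S (pd i F)))"

definition depends_upto :: "nat \<Rightarrow> jet set \<Rightarrow> (jet \<Rightarrow> real) \<Rightarrow> bool" where
  "depends_upto k S F \<longleftrightarrow> (\<forall>u\<in>S. \<forall>v\<in>S. (\<forall>i\<le>k. u i = v i) \<longrightarrow> F u = F v)"

definition smooth_function :: "nat \<Rightarrow> jet set \<Rightarrow> (jet \<Rightarrow> real) \<Rightarrow> bool" where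
  "smooth_function k S F \<longleftrightarrow> depends_upto k S F \<and> (\<forall>n. Ck_on n S F)"

text \<open>An inequality \<open>F \<noteq> 0\<close> between functions, understood generically.\<close>

definition generically_nonzero :: "jet set \<Rightarrow> (jet \<Rightarrow> real) \<Rightarrow> bool" where
  "generically_nonzero S F \<longleftrightarrow> (\<exists>V. open V \<and> V \<noteq> {} \<and> V \<subseteq> S \<and> (\<forall>u\<in>V. F u \<noteq> 0))"

text \<open>
  Total derivatives. In \<open>Dt\<close> the argument \<open>v\<close> lists the values of \<open>z\<^sub>i\<^sub>t\<close>. The sums run over all
  \<open>i\<close> and are finite for functions of finite order, where almost all terms vanish.
\<close>

definition Dx :: "(jet \<Rightarrow> real) \<Rightarrow> jet \<Rightarrow> real" where
  "Dx F u = (\<Sum>i | pd i F u \<noteq> 0. u (Suc i) * pd i F u)"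

definition Dt :: "(jet \<Rightarrow> real) \<Rightarrow> jet \<Rightarrow> jet \<Rightarrow> real" where
  "Dt F u v = (\<Sum>i | pd i F u \<noteq> 0. v i * pd i F u)"

section \<open>Jets of a real function of x and t\<close>

definition dx :: "(real \<Rightarrow> real \<Rightarrow> real) \<Rightarrow> real \<Rightarrow> real \<Rightarrow> real" where
  "dx z x t = deriv (\<lambda>s. z s t) x"

definition dt :: "(real \<Rightarrow> real \<Rightarrow> real) \<Rightarrow> real \<Rightarrow> real \<Rightarrow> real" where
  "dt z x t = deriv (\<lambda>s. z x s) t"

fun Ck_plane :: "nat \<Rightarrow> (real \<times> real) set \<Rightarrow> (real \<Rightarrow> real \<Rightarrow> real) \<Rightarrow> bool" where
  "Ck_plane 0 D z = continuous_on D (\<lambda>(x, t). z x t)"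
| "Ck_plane (Suc n) D z =
    (continuous_on D (\<lambda>(x, t). z x t) \<and>
     (\<forall>(x, t)\<in>D. (\<lambda>s. z s t) differentiable (at x) \<and> (\<lambda>s. z x s) differentiable (at t)) \<and>
     Ck_plane n D (dx z) \<and> Ck_plane n D (dt z))"

definition smooth_plane :: "(real \<times> real) set \<Rightarrow> (real \<Rightarrow> real \<Rightarrow> real) \<Rightarrow> bool" where
  "smooth_plane D z \<longleftrightarrow> (\<forall>n. Ck_plane n D z)"

definition xjet :: "(real \<Rightarrow> real \<Rightarrow> real) \<Rightarrow> real \<Rightarrow> real \<Rightarrow> jet" where
  "xjet z x t = (\<lambda>i. (dx ^^ i) z x t)"

definition xjet_t :: "(real \<Rightarrow> real \<Rightarrow> real) \<Rightarrow> real \<Rightarrow> real \<Rightarrow> jet" where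
  "xjet_t z x t = (\<lambda>i. dt ((dx ^^ i) z) x t)"

section \<open>Equations describing pseudospherical or spherical surfaces\<close>

text \<open>
  \<open>f i j\<close> (used for \<open>i \<in> {1, 2, 3}\<close>, \<open>j \<in> {1, 2}\<close>) are the coefficients of
  \<open>\<omega>\<^sub>i = f\<^sub>i\<^sub>1 dx + f\<^sub>i\<^sub>2 dt\<close>. The \<open>dx \<and> dt\<close> coefficients of \<open>\<omega>\<^sub>i \<and> \<omega>\<^sub>j\<close> and of \<open>d\<omega>\<^sub>i\<close>:
\<close>

definition wedge :: "(nat \<Rightarrow> nat \<Rightarrow> jet \<Rightarrow> real) \<Rightarrow> nat \<Rightarrow> nat \<Rightarrow> jet \<Rightarrow> real" where
  "wedge f i j u = f i 1 u * f j 2 u - f i 2 u * f j 1 u"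

definition ext_d :: "(nat \<Rightarrow> nat \<Rightarrow> jet \<Rightarrow> real) \<Rightarrow> nat \<Rightarrow> jet \<Rightarrow> jet \<Rightarrow> real" where
  "ext_d f i u v = Dx (f i 2) u - Dt (f i 1) u v"

definition structure_equations ::
  "real \<Rightarrow> (nat \<Rightarrow> nat \<Rightarrow> jet \<Rightarrow> real) \<Rightarrow> jet \<Rightarrow> jet \<Rightarrow> bool" where
  "structure_equations \<delta> f u v \<longleftrightarrow>
     ext_d f 1 u v = wedge f 3 2 u \<and>
     ext_d f 2 u v = wedge f 1 3 u \<and>
     ext_d f 3 u v = \<delta> * wedge f 1 2 u"

text \<open>
  The equation \<open>z\<^sub>2\<^sub>t = A z\<^sub>3 + B\<close> over the jet domain \<open>S\<close> describes pss (\<open>\<delta> = 1\<close>) or ss (\<open>\<delta> = -1\<close>)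
  with corresponding functions \<open>f\<close>. Equivalence with the structure equations is an equivalence of
  differential equations, i.e. for every \<open>z\<close> it holds at every point \<open>(x, t)\<close>.
\<close>

definition describes ::
  "real \<Rightarrow> jet set \<Rightarrow> (jet \<Rightarrow> real) \<Rightarrow> (jet \<Rightarrow> real) \<Rightarrow> (nat \<Rightarrow> nat \<Rightarrow> jet \<Rightarrow> real) \<Rightarrow> bool" where
  "describes \<delta> S A B f \<longleftrightarrow>
     (\<exists>k. \<forall>i\<in>{1, 2, 3}. \<forall>j\<in>{1, 2}. smooth_function k S (f i j)) \<and>
     (\<forall>D z. open D \<and> smooth_plane D z \<longrightarrow>
        (\<forall>(x, t)\<in>D. xjet z x t \<in> S \<longrightarrow>
           (dt ((dx ^^ 2) z) x t = A (xjet z x t) * (dx ^^ 3) z x t + B (xjet z x t) \<longleftrightarrow>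
            structure_equations \<delta> f (xjet z x t) (xjet_t z x t)))) \<and>
     generically_nonzero S (wedge f 1 2)"

definition conditions_f1 :: "real \<Rightarrow> jet set \<Rightarrow> (nat \<Rightarrow> nat \<Rightarrow> jet \<Rightarrow> real) \<Rightarrow> bool" where
  "conditions_f1 \<delta> S f \<longleftrightarrow>
     (\<exists>\<eta>. \<forall>u\<in>S. f 1 1 u = \<eta>) \<and>
     (\<exists>p q r. \<forall>u\<in>S. f 2 1 u = p * u 0 + q * u 2 + r) \<and>
     (\<exists>p q r. \<forall>u\<in>S. f 3 1 u = p * u 0 + q * u 2 + r) \<and>
     (\<forall>u\<in>S. (pd 2 (f 3 1) u)\<^sup>2 - \<delta> * (pd 2 (f 2 1) u)\<^sup>2 = 0)"

section \<open>Linear coordinate transformations\<close>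

text \<open>
  The new variables are \<open>a x\<close>, \<open>b t\<close>, \<open>c z + c\<^sub>0\<close>, so the new \<open>z\<^sub>i\<close> is \<open>c z\<^sub>i / a\<^sup>i\<close>, plus \<open>c\<^sub>0\<close> if
  \<open>i = 0\<close>; \<open>old_jet\<close> recovers the old jet from the new one. Moreover the new \<open>z\<^sub>2\<^sub>t\<close> is
  \<open>c z\<^sub>2\<^sub>t / (a\<^sup>2 b)\<close>, and \<open>dx\<close>, \<open>dt\<close> in the 1-forms are \<open>1/a\<close>, \<open>1/b\<close> times their new counterparts.
\<close>

definition old_jet :: "real \<Rightarrow> real \<Rightarrow> real \<Rightarrow> jet \<Rightarrow> jet" where
  "old_jet a c c0 u = (\<lambda>i. a ^ i * (u i - (if i = 0 then c0 else 0)) / c)"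

definition transform_dom :: "real \<Rightarrow> real \<Rightarrow> real \<Rightarrow> jet set \<Rightarrow> jet set" where
  "transform_dom a c c0 S = {u. old_jet a c c0 u \<in> S}"

definition transform_A ::
  "real \<Rightarrow> real \<Rightarrow> real \<Rightarrow> real \<Rightarrow> (jet \<Rightarrow> real) \<Rightarrow> jet \<Rightarrow> real" where
  "transform_A a b c c0 A u = a / b * A (old_jet a c c0 u)"

definition transform_B ::
  "real \<Rightarrow> real \<Rightarrow> real \<Rightarrow> real \<Rightarrow> (jet \<Rightarrow> real) \<Rightarrow> jet \<Rightarrow> real" where
  "transform_B a b c c0 B u = c / (a\<^sup>2 * b) * B (old_jet a c c0 u)"

definition transform_forms ::
  "real \<Rightarrow> real \<Rightarrow> real \<Rightarrow> real \<Rightarrow> (nat \<Rightarrow> nat \<Rightarrow> jet \<Rightarrow> real) \<Rightarrow> nat \<Rightarrow> nat \<Rightarrow> jet \<Rightarrow> real" where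
  "transform_forms a b c c0 f i j u =
     (if j = 1 then 1 / a else 1 / b) * f i j (old_jet a c c0 u)"

section \<open>The two forms\<close>

text \<open>\<open>\<epsilon>\<close> is \<open>1\<close> for the upper and \<open>-1\<close> for the lower signs.\<close>

definition form_I ::
  "jet set \<Rightarrow> (jet \<Rightarrow> real) \<Rightarrow> (jet \<Rightarrow> real) \<Rightarrow> (nat \<Rightarrow> nat \<Rightarrow> jet \<Rightarrow> real) \<Rightarrow> bool" where
  "form_I S A B f \<longleftrightarrow>
     (\<exists>\<epsilon>\<in>{1, -1}. \<exists>a\<in>{0, 1}. \<exists>b\<in>{0, 1}. \<exists>\<alpha> m n. \<exists>\<psi>.
        smooth_function 2 S \<psi> \<and>
        (a - 1) * \<alpha> * m = 0 \<and> (a - 1) * b = 0 \<and>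
        generically_nonzero S (\<lambda>u. a * \<psi> u + b * u 2 + m\<^sup>2 + n\<^sup>2) \<and>
        (\<forall>u\<in>S.
           A u * u 3 + B u = Dx \<psi> u + a * \<psi> u + b * u 2 + \<epsilon> * n * (1 - a) * \<alpha> \<and>
           f 1 1 u = - \<epsilon> * a \<and>
           f 1 2 u = (1 - a) * (m * u 1 + n) + \<epsilon> * b \<and>
           f 2 1 u = u 2 + \<alpha> \<and>
           f 2 2 u = \<psi> u - \<epsilon> * (1 - a) * (m / 2 * (u 1)\<^sup>2 + n * u 1) - \<alpha> * b \<and>
           f 3 1 u = \<epsilon> * f 2 1 u \<and>
           f 3 2 u = \<epsilon> * f 2 2 u - (1 - a) * m))"

definition form_II ::
  "jet set \<Rightarrow> (jet \<Rightarrow> real) \<Rightarrow> (jet \<Rightarrow> real) \<Rightarrow> (nat \<Rightarrow> nat \<Rightarrow> jet \<Rightarrow> real) \<Rightarrow> bool" where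
  "form_II S A B f \<longleftrightarrow>
     (\<exists>\<epsilon>\<in>{1, -1}. \<exists>\<alpha> \<beta> \<eta>. \<exists>h :: real \<Rightarrow> real.
        let m = \<epsilon> * (\<alpha>\<^sup>2 - \<beta>\<^sup>2 - \<eta>\<^sup>2); H = (\<lambda>u :: jet. h (u 0)) in
        \<alpha> - \<epsilon> * \<beta> \<noteq> 0 \<and>
        smooth_function 0 S H \<and>
        generically_nonzero S (\<lambda>u. deriv h (u 0)) \<and>
        (\<forall>u\<in>S.
           A u * u 3 + B u =
             - \<epsilon> * (Dx ^^ 3) H u - Dx (\<lambda>w. (w 2 + m) * H w) u - u 2 * Dx H u \<and>
           f 1 1 u = \<eta> \<and>
           f 1 2 u = - \<epsilon> * Dx H u - \<eta> * H u \<and>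
           f 2 1 u = u 2 / (\<alpha> - \<epsilon> * \<beta>) + \<beta> \<and>
           f 2 2 u = (- \<epsilon> * (Dx ^^ 2) H u - \<eta> * Dx H u) / (\<alpha> - \<epsilon> * \<beta>)
                     - (u 2 / (\<alpha> - \<epsilon> * \<beta>) + \<beta>) * H u \<and>
           f 3 1 u = \<epsilon> * u 2 / (\<alpha> - \<epsilon> * \<beta>) + \<alpha> \<and>
           f 3 2 u = (- (Dx ^^ 2) H u - \<epsilon> * \<eta> * Dx H u) / (\<alpha> - \<epsilon> * \<beta>)
                     - \<epsilon> * (u 2 / (\<alpha> - \<epsilon> * \<beta>) + \<epsilon> * \<alpha>) * H u))"

definition canonical_form ::
  "real \<Rightarrow> jet set \<Rightarrow> (jet \<Rightarrow> real) \<Rightarrow> (jet \<Rightarrow> real) \<Rightarrow> (nat \<Rightarrow> nat \<Rightarrow> jet \<Rightarrow> real) \<Rightarrow> bool" where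
  "canonical_form \<delta> S A B f \<longleftrightarrow>
     \<delta> = 1 \<and>
     (\<exists>a b c c0. a * b * c \<noteq> 0 \<and>
        (let S' = transform_dom a c c0 S; A' = transform_A a b c c0 A;
             B' = transform_B a b c c0 B; f' = transform_forms a b c c0 f
         in form_I S' A' B' f' \<or> form_II S' A' B' f'))"

end

theory Submission
  imports Defs
begin

text \<open>
  On jets over a convex domain an equation describes surfaces exactly when the structure equations
  hold pointwise with \<open>z\<^sub>2\<^sub>t = A z\<^sub>3 + B\<close>, since every finite jet is attained by some \<open>P(x) + t Q(x)\<close> with
  polynomials \<open>P\<close> and \<open>Q\<close>. Since \<open>z\<^sub>2\<^sub>t\<close> must occur while \<open>z\<^sub>t\<close> must not, \<open>\<delta> = 1\<close>, \<open>f\<^sub>2\<^sub>1 = q z\<^sub>2 + r\<close> and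
  \<open>f\<^sub>3\<^sub>1 = \<epsilon> q z\<^sub>2 + s\<close> with \<open>\<epsilon> = \<plusminus>1\<close>. Put \<open>\<kappa> = s - \<epsilon> r\<close> and \<open>g = f\<^sub>3\<^sub>2 - \<epsilon> f\<^sub>2\<^sub>2\<close>. Counting orders of
  derivatives shows that \<open>g\<close> depends on \<open>z\<close> only, and the structure equations become
  \<open>D\<^sub>x f\<^sub>1\<^sub>2 = \<kappa> f\<^sub>2\<^sub>2 - g (q z\<^sub>2 + r)\<close> and \<open>D\<^sub>x g = \<epsilon> \<kappa> f\<^sub>1\<^sub>2 - \<epsilon> \<eta> g\<close>, besides the one that gives the equation itself.
  If \<open>\<kappa> \<noteq> 0\<close>, these express everything through \<open>h = - g / \<kappa>\<close>, which is form (II); if \<open>\<kappa> = 0\<close>, then \<open>g\<close> is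
  constant, \<open>f\<^sub>1\<^sub>2\<close> is affine in \<open>z\<^sub>1\<close>, \<open>f\<^sub>2\<^sub>2\<close> is free, and rescaling gives form (I).
  Conversely, the forms satisfy the structure equations. Form (I) can have \<open>\<omega>\<^sub>1 \<and> \<omega>\<^sub>2 = 0\<close>, but then the
  equation is \<open>z\<^sub>2\<^sub>t = - z\<^sub>3\<close>, for which other forms with \<open>\<omega>\<^sub>1 \<and> \<omega>\<^sub>2 \<noteq> 0\<close> exist.
\<close>

section \<open>Calculus on jets\<close>

lemma continuous_on_fun_upd: "continuous_on UNIV (\<lambda>s. (u :: jet)(i := s))"
proof (rule continuous_on_coordinatewise_then_product)
  show "continuous_on UNIV (\<lambda>s. (u(i := s)) j)" for j
    by (cases "j = i") auto
qed

lemma open_jets_over: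
  assumes "open U"
  shows "open (jets_over U)"
proof -
  have "jets_over U = (\<lambda>u. (u 0, u 1, u 2)) -` U"
    by (auto simp: jets_over_def)
  moreover have "continuous_on UNIV (\<lambda>u :: jet. (u 0, u 1, u 2))"
    by (intro continuous_intros continuous_on_product_coordinates)
  ultimately show ?thesis
    using assms by (simp add: open_vimage)
qed

lemma eventually_upd_in:
  assumes "open (S :: jet set)" "u \<in> S"
  shows "eventually (\<lambda>s. u(i := s) \<in> S) (nhds (u i))"
proof -
  have "open ((\<lambda>s. u(i := s)) -` S)"
    using assms(1) continuous_on_fun_upd by (rule open_vimage)
  moreover have "u i \<in> (\<lambda>s. u(i := s)) -` S"
    using assms(2) by simp
  ultimately show ?thesis
    unfolding eventually_nhds by (intro exI[of _ "(\<lambda>s. u(i := s)) -` S"]) auto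
qed

text \<open>Each coordinate can be moved separately inside an open set of the product topology; this
  supplies the second test jet when a coefficient is read off.\<close>

lemma exists_other_upd_in:
  assumes "open (S :: jet set)" "u \<in> S"
  obtains s where "u(i := s) \<in> S" "s \<noteq> u i"
proof -
  obtain d where d: "d > 0" "\<forall>s. dist s (u i) < d \<longrightarrow> u(i := s) \<in> S"
    using eventually_upd_in[OF assms] unfolding eventually_nhds_metric by blast
  show thesis
    by (rule that[of "u i + d / 2"]) (use d in \<open>auto simp: dist_real_def\<close>)
qed

section \<open>Functions of bounded order\<close>

lemma depends_uptoD:
  "depends_upto k S F \<Longrightarrow> u \<in> S \<Longrightarrow> v \<in> S \<Longrightarrow> (\<And>i. i \<le> k \<Longrightarrow> u i = v i) \<Longrightarrow> F u = F v"
  unfolding depends_upto_def by blast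

lemma depends_uptoI:
  "(\<And>u v. u \<in> S \<Longrightarrow> v \<in> S \<Longrightarrow> (\<And>i. i \<le> k \<Longrightarrow> u i = v i) \<Longrightarrow> F u = F v) \<Longrightarrow>
    depends_upto k S F"
  unfolding depends_upto_def by blast

lemma depends_upto_mono: "depends_upto k S F \<Longrightarrow> k \<le> l \<Longrightarrow> depends_upto l S F"
  by (rule depends_uptoI, erule depends_uptoD) auto

lemma depends_upto_const: "depends_upto k S (\<lambda>u. c)"
  by (simp add: depends_upto_def)

lemma depends_upto_coord: "i \<le> k \<Longrightarrow> depends_upto k S (\<lambda>u. u i)"
  by (simp add: depends_upto_def)

lemma depends_upto_compose2:
  assumes "depends_upto k S F" "depends_upto k S G"
  shows "depends_upto k S (\<lambda>u. f (F u) (G u))"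
proof (rule depends_uptoI)
  fix u v assume "u \<in> S" "v \<in> S" "\<And>i. i \<le> k \<Longrightarrow> u i = v i"
  then have "F u = F v" "G u = G v"
    using assms depends_uptoD[of k S F u v] depends_uptoD[of k S G u v] by auto
  then show "f (F u) (G u) = f (F v) (G v)"
    by simp
qed

lemmas depends_upto_intros =
  depends_upto_const depends_upto_coord depends_upto_compose2[where f = "(+)"]
  depends_upto_compose2[where f = "(-)"] depends_upto_compose2[where f = "(*)"]

section \<open>Partial derivatives\<close>

lemma pd_eqI:
  assumes "((\<lambda>s. F (u(i := s))) has_field_derivative D) (at (u i))"
  shows "pd i F u = D"
  using assms unfolding pd_def by (rule DERIV_imp_deriv)

lemma pd_cong:
  assumes "open S" "\<And>u. u \<in> S \<Longrightarrow> F u = G u" "u \<in> S"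
  shows "pd i F u = pd i G u"
proof -
  have "eventually (\<lambda>s. F (u(i := s)) = G (u(i := s))) (nhds (u i))"
    by (rule eventually_mono[OF eventually_upd_in[OF assms(1,3), of i]]) (simp add: assms(2))
  then show ?thesis
    unfolding pd_def by (intro deriv_cong_ev refl)
qed

lemma differentiable_cong_jet:
  fixes F G :: "jet \<Rightarrow> real"
  assumes "open S" "\<And>u. u \<in> S \<Longrightarrow> F u = G u" "u \<in> S"
    "(\<lambda>s. F (u(i := s))) differentiable (at (u i))"
  shows "(\<lambda>s. G (u(i := s))) differentiable (at (u i))"
proof -
  have "eventually (\<lambda>s. F (u(i := s)) = G (u(i := s))) (nhds (u i))"
    by (rule eventually_mono[OF eventually_upd_in[OF assms(1,3), of i]]) (simp add: assms(2))
  then have "((\<lambda>s. F (u(i := s))) has_field_derivative D) (at (u i)) \<longleftrightarrow>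
      ((\<lambda>s. G (u(i := s))) has_field_derivative D) (at (u i))" for D
    by (intro DERIV_cong_ev refl)
  then show ?thesis
    using assms(4) by (simp add: real_differentiable_def)
qed

text \<open>\<open>pd\<close> looks at a function near a point; since \<open>S\<close> is open,
  equality on \<open>S\<close> passes on to all partial derivatives, and the induction runs over all
  pairs \<open>F\<close>, \<open>G\<close>. This permits replacing a derivative by a formula that is
  valid on \<open>S\<close> only.\<close>

lemma Ck_on_cong:
  assumes "open S" "\<And>u. u \<in> S \<Longrightarrow> F u = G u" "Ck_on n S F"
  shows "Ck_on n S G"
  using assms(2,3)
proof (induction n arbitrary: F G)
  case 0
  then show ?case
    using continuous_on_cong[of S S F G] by simp
next
  case (Suc n)
  have "continuous_on S G"
    using Suc.prems continuous_on_cong[of S S F G] by simp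
  moreover have "(\<lambda>s. G (u(i := s))) differentiable (at (u i))" if "u \<in> S" for u i
    using differentiable_cong_jet[of S F G u i] assms(1) Suc.prems that by auto
  moreover have "Ck_on n S (pd i G)" for i
    by (rule Suc.IH[of "pd i F"]) (use pd_cong[of S F G] assms(1) Suc.prems in auto)
  ultimately show ?case
    by simp
qed

lemma Ck_on_Suc_D: "Ck_on (Suc n) S F \<Longrightarrow> Ck_on n S F"
  by (induction n arbitrary: F) auto

lemma Ck_on_imp_continuous_on: "Ck_on n S F \<Longrightarrow> continuous_on S F"
  by (cases n) auto

lemma Ck_on_has_pd:
  assumes "Ck_on (Suc n) S F" "u \<in> S"
  shows "((\<lambda>s. F (u(i := s))) has_field_derivative pd i F u) (at (u i))"
  using assms unfolding pd_def by (simp add: DERIV_deriv_iff_real_differentiable)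

section \<open>Closure properties of smooth functions\<close>

lemma Ck_on_const: "Ck_on n S (\<lambda>u. c)"
proof (induction n arbitrary: c)
  case (Suc n)
  have "pd i (\<lambda>u. c) = (\<lambda>u. 0)" for i
    by (auto simp: pd_def)
  with Suc show ?case
    by simp
qed simp

lemma pd_coord: "pd i (\<lambda>u. u j) u = (if i = j then 1 else 0)"
  by (rule pd_eqI) auto

lemma Ck_on_coord: "Ck_on n S (\<lambda>u. u j)"
proof (cases n)
  case (Suc n)
  have "pd i (\<lambda>u. u j) = (\<lambda>u. if i = j then 1 else 0)" for i
    by (auto simp: pd_coord)
  moreover have "continuous_on S (\<lambda>u :: jet. u j)"
    by (rule continuous_on_subset[OF continuous_on_product_coordinates]) simp
  moreover have "(\<lambda>s. (u(i := s)) j) differentiable (at (u i))" for u :: jet and i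
    by (cases "j = i") auto
  ultimately show ?thesis
    using Suc Ck_on_const[of n S 1] Ck_on_const[of n S 0] by auto
next
  case 0
  then show ?thesis
    using continuous_on_subset[OF continuous_on_product_coordinates] by auto
qed

lemma Ck_on_add:
  assumes "open S" "Ck_on n S F" "Ck_on n S G"
  shows "Ck_on n S (\<lambda>u. F u + G u)"
  using assms(2,3)
proof (induction n arbitrary: F G)
  case (Suc n)
  have D: "((\<lambda>s. F (u(i := s)) + G (u(i := s))) has_field_derivative pd i F u + pd i G u) (at (u i))"
    if "u \<in> S" for u i
    by (rule DERIV_add[OF Ck_on_has_pd[OF Suc.prems(1) that] Ck_on_has_pd[OF Suc.prems(2) that]])
  have "Ck_on n S (pd i (\<lambda>u. F u + G u))" for i
    by (rule Ck_on_cong[OF assms(1), of "\<lambda>u. pd i F u + pd i G u"])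
      (use Suc in \<open>simp_all add: pd_eqI[OF D]\<close>)
  moreover have "\<forall>u\<in>S. (\<lambda>s. F (u(i := s)) + G (u(i := s))) differentiable (at (u i))" for i
    using D by (auto simp: real_differentiable_def)
  moreover have "continuous_on S (\<lambda>u. F u + G u)"
    using Suc.prems Ck_on_imp_continuous_on by (intro continuous_on_add) auto
  ultimately show ?case
    by simp
qed (simp add: continuous_on_add)

lemma Ck_on_mult:
  assumes "open S" "Ck_on n S F" "Ck_on n S G"
  shows "Ck_on n S (\<lambda>u. F u * G u)"
  using assms(2,3)
proof (induction n arbitrary: F G)
  case (Suc n)
  have D: "((\<lambda>s. F (u(i := s)) * G (u(i := s))) has_field_derivative
      pd i F u * G u + pd i G u * F u) (at (u i))"
    if "u \<in> S" for u i
    using DERIV_mult[OF Ck_on_has_pd[OF Suc.prems(1) that, of i] Ck_on_has_pd[OF Suc.prems(2) that, of i]]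
    unfolding fun_upd_triv .
  have "Ck_on n S (pd i (\<lambda>u. F u * G u))" for i
    by (rule Ck_on_cong[OF assms(1), of "\<lambda>u. pd i F u * G u + pd i G u * F u"],
        simp add: pd_eqI[OF D], intro Ck_on_add[OF assms(1)] Suc.IH)
      (use Suc.prems Ck_on_Suc_D[of n S F] Ck_on_Suc_D[of n S G] in auto)
  moreover have "\<forall>u\<in>S. (\<lambda>s. F (u(i := s)) * G (u(i := s))) differentiable (at (u i))" for i
    using D by (auto simp: real_differentiable_def)
  moreover have "continuous_on S (\<lambda>u. F u * G u)"
    using Suc.prems Ck_on_imp_continuous_on by (intro continuous_on_mult) auto
  ultimately show ?case
    by simp
qed (simp add: continuous_on_mult)

lemma smooth_function_cong:
  assumes "open S" "\<And>u. u \<in> S \<Longrightarrow> F u = G u" "smooth_function k S F"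
  shows "smooth_function k S G"
proof -
  have "depends_upto k S G"
  proof (rule depends_uptoI)
    fix u v assume "u \<in> S" "v \<in> S" "\<And>i. i \<le> k \<Longrightarrow> u i = v i"
    then show "G u = G v"
      using depends_uptoD[of k S F u v] assms by (simp add: smooth_function_def)
  qed
  then show ?thesis
    using assms Ck_on_cong[of S F G] by (auto simp: smooth_function_def)
qed

lemma smooth_function_mono: "smooth_function k S F \<Longrightarrow> k \<le> l \<Longrightarrow> smooth_function l S F"
  using depends_upto_mono by (auto simp: smooth_function_def)

lemma smooth_function_const: "smooth_function k S (\<lambda>u. c)"
  by (simp add: smooth_function_def depends_upto_def Ck_on_const)

lemma smooth_function_coord: "i \<le> k \<Longrightarrow> smooth_function k S (\<lambda>u. u i)"
  by (simp add: smooth_function_def depends_upto_def Ck_on_coord)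

lemma smooth_function_add:
  assumes "open S" "smooth_function k S F" "smooth_function k S G"
  shows "smooth_function k S (\<lambda>u. F u + G u)"
proof -
  have "depends_upto k S (\<lambda>u. F u + G u)"
    using assms(2,3) by (intro depends_upto_intros) (auto simp: smooth_function_def)
  then show ?thesis
    using assms Ck_on_add[of S _ F G] by (simp add: smooth_function_def)
qed

lemma smooth_function_mult:
  assumes "open S" "smooth_function k S F" "smooth_function k S G"
  shows "smooth_function k S (\<lambda>u. F u * G u)"
proof -
  have "depends_upto k S (\<lambda>u. F u * G u)"
    using assms(2,3) by (intro depends_upto_intros) (auto simp: smooth_function_def)
  then show ?thesis
    using assms Ck_on_mult[of S _ F G] by (simp add: smooth_function_def)
qed

lemma smooth_function_minus:
  assumes "open S" "smooth_function k S F"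
  shows "smooth_function k S (\<lambda>u. - F u)"
  using smooth_function_mult[OF assms(1) smooth_function_const[of k S "-1"] assms(2)] by simp

lemma smooth_function_diff:
  assumes "open S" "smooth_function k S F" "smooth_function k S G"
  shows "smooth_function k S (\<lambda>u. F u - G u)"
  using smooth_function_add[OF assms(1,2) smooth_function_minus[OF assms(1,3)]] by simp

lemma smooth_function_divide:
  assumes "open S" "smooth_function k S F"
  shows "smooth_function k S (\<lambda>u. F u / c)"
  using smooth_function_mult[OF assms smooth_function_const[of k S "inverse c"]]
  by (simp add: divide_inverse)

lemma smooth_function_power:
  assumes "open S" "smooth_function k S F"
  shows "smooth_function k S (\<lambda>u. F u ^ n)"
  by (induction n) (use assms in \<open>auto intro: smooth_function_const smooth_function_mult\<close>)

lemma smooth_function_sum: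
  assumes "open S" "\<And>j. j \<in> J \<Longrightarrow> smooth_function k S (F j)"
  shows "smooth_function k S (\<lambda>u. \<Sum>j\<in>J. F j u)"
  using assms(2)
  by (induction J rule: infinite_finite_induct)
    (auto intro: smooth_function_const smooth_function_add assms(1))

lemmas smooth_function_intros =
  smooth_function_const smooth_function_coord smooth_function_add smooth_function_mult
  smooth_function_minus smooth_function_diff smooth_function_divide smooth_function_power

lemma smooth_function_has_pd:
  assumes "smooth_function k S F" "u \<in> S"
  shows "((\<lambda>s. F (u(i := s))) has_field_derivative pd i F u) (at (u i))"
  using assms by (intro Ck_on_has_pd[of 0]) (auto simp: smooth_function_def simp del: Ck_on.simps)

lemma smooth_function_imp_continuous_on: "smooth_function k S F \<Longrightarrow> continuous_on S F"
  unfolding smooth_function_def by (auto intro: Ck_on_imp_continuous_on[of 0])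

text \<open>Moving a coordinate beyond the order does not change \<open>F\<close> as long as the jet
  stays in \<open>S\<close>, so locally a constant is differentiated.\<close>

lemma pd_eq_0_beyond:
  assumes "open S" "depends_upto k S F" "u \<in> S" "k < i"
  shows "pd i F u = 0"
proof -
  have "eventually (\<lambda>s. F (u(i := s)) = F u) (nhds (u i))"
    by (rule eventually_mono[OF eventually_upd_in[OF assms(1,3), of i]], rule depends_uptoD[OF assms(2)])
      (use assms in auto)
  then have "pd i F u = deriv (\<lambda>s. F u) (u i)"
    unfolding pd_def by (intro deriv_cong_ev refl)
  then show ?thesis
    by simp
qed

text \<open>For \<open>i \<le> k\<close> the restrictions of \<open>F\<close> to coordinate
  \<open>i\<close> through \<open>u\<close> and \<open>v\<close> agree near the common value
  \<open>u i = v i\<close>; for larger \<open>i\<close> both derivatives vanish.\<close>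

lemma depends_upto_pd:
  assumes "open S" "depends_upto k S F"
  shows "depends_upto k S (pd i F)"
proof (rule depends_uptoI)
  fix u v assume uv: "u \<in> S" "v \<in> S" "\<And>j. j \<le> k \<Longrightarrow> u j = v j"
  show "pd i F u = pd i F v"
  proof (cases "i \<le> k")
    case True
    then have "u i = v i"
      using uv by simp
    have "eventually (\<lambda>s. u(i := s) \<in> S \<and> v(i := s) \<in> S) (nhds (u i))"
      using eventually_upd_in[OF assms(1) uv(1), of i] eventually_upd_in[OF assms(1) uv(2), of i]
      unfolding \<open>u i = v i\<close> by (rule eventually_conj)
    then have "eventually (\<lambda>s. F (u(i := s)) = F (v(i := s))) (nhds (u i))"
      by (rule eventually_mono, intro depends_uptoD[OF assms(2)]) (use uv(3) in auto)
    then show ?thesis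
      unfolding pd_def by (rule deriv_cong_ev) fact
  next
    case False
    then show ?thesis
      by (simp add: pd_eq_0_beyond[OF assms] uv)
  qed
qed

lemma smooth_function_pd:
  assumes "open S" "smooth_function k S F"
  shows "smooth_function k S (pd i F)"
proof -
  have "Ck_on n S (pd i F)" for n
    using assms(2) unfolding smooth_function_def by (auto dest: spec[of _ "Suc n"])
  then show ?thesis
    using assms depends_upto_pd[of S k F i] by (simp add: smooth_function_def)
qed

section \<open>Total derivatives\<close>

text \<open>The index set in \<open>Dx\<close> and \<open>Dt\<close> varies with the function and
  the jet. The fixed range \<open>{..l}\<close> only adds zero terms and makes different sums
  comparable.\<close>

lemma sum_pd_eq:
  assumes "open S" "depends_upto k S F" "u \<in> S" "k \<le> l"
  shows "(\<Sum>i | pd i F u \<noteq> 0. w i * pd i F u) = (\<Sum>i\<le>l. w i * pd i F u)"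
proof (rule sum.mono_neutral_left)
  show "{i. pd i F u \<noteq> 0} \<subseteq> {..l}"
    using pd_eq_0_beyond[OF assms(1-3)] assms(4) by (force simp: not_less)
qed auto

lemma Dx_eq_sum:
  assumes "open S" "depends_upto k S F" "u \<in> S" "k \<le> l"
  shows "Dx F u = (\<Sum>i\<le>l. u (Suc i) * pd i F u)"
  unfolding Dx_def by (rule sum_pd_eq[OF assms])

lemma Dt_eq_sum:
  assumes "open S" "depends_upto k S F" "u \<in> S" "k \<le> l"
  shows "Dt F u v = (\<Sum>i\<le>l. v i * pd i F u)"
  unfolding Dt_def by (rule sum_pd_eq[OF assms])

lemma smooth_function_Dx:
  assumes "open S" "smooth_function k S F"
  shows "smooth_function (Suc k) S (Dx F)"
proof (rule smooth_function_cong[OF assms(1)])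
  show "(\<Sum>i\<le>k. u (Suc i) * pd i F u) = Dx F u" if "u \<in> S" for u
    using Dx_eq_sum[of S k F u k] assms that by (simp add: smooth_function_def)
  show "smooth_function (Suc k) S (\<lambda>u. \<Sum>i\<le>k. u (Suc i) * pd i F u)"
    using assms smooth_function_mono[OF smooth_function_pd[OF assms], of "Suc k"]
    by (intro smooth_function_sum smooth_function_mult smooth_function_coord) auto
qed

lemma Dx_cong:
  assumes "open S" "\<And>u. u \<in> S \<Longrightarrow> F u = G u" "u \<in> S"
  shows "Dx F u = Dx G u"
  unfolding Dx_def using pd_cong[OF assms] by simp

lemma Dt_cong:
  assumes "open S" "\<And>u. u \<in> S \<Longrightarrow> F u = G u" "u \<in> S"
  shows "Dt F u v = Dt G u v"
  unfolding Dt_def using pd_cong[OF assms] by simp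

lemma Dx_const [simp]: "Dx (\<lambda>u. c) u = 0"
  by (simp add: Dx_def pd_def)

lemma Dt_const [simp]: "Dt (\<lambda>u. c) u v = 0"
  by (simp add: Dt_def pd_def)

lemma Dx_coord [simp]: "Dx (\<lambda>u. u j) u = u (Suc j)"
  by (simp add: Dx_def pd_coord)

lemma pd_add:
  assumes "smooth_function k S F" "smooth_function l S G" "u \<in> S"
  shows "pd i (\<lambda>u. F u + G u) u = pd i F u + pd i G u"
  by (rule pd_eqI[OF DERIV_add[OF smooth_function_has_pd[OF assms(1,3)] smooth_function_has_pd[OF assms(2,3)]]])

lemma pd_mult:
  assumes "smooth_function k S F" "smooth_function l S G" "u \<in> S"
  shows "pd i (\<lambda>u. F u * G u) u = pd i F u * G u + pd i G u * F u"
  using DERIV_mult[OF smooth_function_has_pd[OF assms(1,3), of i] smooth_function_has_pd[OF assms(2,3), of i]]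
  by (intro pd_eqI) simp

text \<open>\<open>Dx\<close> raises the order by one, so the rules for \<open>Dx\<close> are stated
  for functions of some finite order, a class that is closed under \<open>Dx\<close> and the
  arithmetic operations used here.\<close>

definition jet_smooth :: "jet set \<Rightarrow> (jet \<Rightarrow> real) \<Rightarrow> bool" where
  "jet_smooth S F \<longleftrightarrow> (\<exists>k. smooth_function k S F)"

lemma jet_smoothI: "smooth_function k S F \<Longrightarrow> jet_smooth S F"
  by (auto simp: jet_smooth_def)

lemma jet_smooth_common:
  assumes "jet_smooth S F" "jet_smooth S G"
  obtains k where "smooth_function k S F" "smooth_function k S G"
proof -
  obtain k l where "smooth_function k S F" "smooth_function l S G"
    using assms unfolding jet_smooth_def by blast
  then show thesis
    using that[of "max k l"] smooth_function_mono by auto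
qed

lemma jet_smooth_const: "jet_smooth S (\<lambda>u. c)"
  and jet_smooth_coord: "jet_smooth S (\<lambda>u. u i)"
  using smooth_function_const smooth_function_coord by (blast intro: jet_smoothI)+

lemma jet_smooth_add:
  assumes "open S" "jet_smooth S F" "jet_smooth S G"
  shows "jet_smooth S (\<lambda>u. F u + G u)"
  by (rule jet_smooth_common[OF assms(2,3)]) (intro jet_smoothI smooth_function_add assms(1))

lemma jet_smooth_mult:
  assumes "open S" "jet_smooth S F" "jet_smooth S G"
  shows "jet_smooth S (\<lambda>u. F u * G u)"
  by (rule jet_smooth_common[OF assms(2,3)]) (intro jet_smoothI smooth_function_mult assms(1))

lemma jet_smooth_diff:
  assumes "open S" "jet_smooth S F" "jet_smooth S G"
  shows "jet_smooth S (\<lambda>u. F u - G u)"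
  by (rule jet_smooth_common[OF assms(2,3)]) (intro jet_smoothI smooth_function_diff assms(1))

lemma jet_smooth_minus: "open S \<Longrightarrow> jet_smooth S F \<Longrightarrow> jet_smooth S (\<lambda>u. - F u)"
  and jet_smooth_divide: "open S \<Longrightarrow> jet_smooth S F \<Longrightarrow> jet_smooth S (\<lambda>u. F u / c)"
  and jet_smooth_power: "open S \<Longrightarrow> jet_smooth S F \<Longrightarrow> jet_smooth S (\<lambda>u. F u ^ n)"
  and jet_smooth_Dx: "open S \<Longrightarrow> jet_smooth S F \<Longrightarrow> jet_smooth S (Dx F)"
  by (auto simp: jet_smooth_def
      dest: smooth_function_minus smooth_function_divide smooth_function_power smooth_function_Dx)

lemmas jet_smooth_intros =
  jet_smooth_const jet_smooth_coord jet_smooth_add jet_smooth_mult jet_smooth_minus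
  jet_smooth_divide jet_smooth_power jet_smooth_Dx jet_smooth_diff

lemma Dx_add:
  assumes "open S" "u \<in> S" "jet_smooth S F" "jet_smooth S G"
  shows "Dx (\<lambda>u. F u + G u) u = Dx F u + Dx G u"
proof -
  obtain k where k: "smooth_function k S F" "smooth_function k S G"
    using jet_smooth_common[OF assms(3,4)] .
  have "smooth_function k S (\<lambda>u. F u + G u)"
    using assms k by (intro smooth_function_intros)
  then show ?thesis
    using k Dx_eq_sum[OF assms(1) _ assms(2) order_refl, of k]
    by (simp add: smooth_function_def[of k S "\<lambda>u. F u + G u"] pd_add[OF k assms(2)] 
        smooth_function_def[of k S F] smooth_function_def[of k S G] sum.distrib distrib_left)
qed

lemma Dx_mult:
  assumes "open S" "u \<in> S" "jet_smooth S F" "jet_smooth S G"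
  shows "Dx (\<lambda>u. F u * G u) u = Dx F u * G u + F u * Dx G u"
proof -
  obtain k where k: "smooth_function k S F" "smooth_function k S G"
    using jet_smooth_common[OF assms(3,4)] .
  have "smooth_function k S (\<lambda>u. F u * G u)"
    using assms k by (intro smooth_function_intros)
  then have "Dx (\<lambda>u. F u * G u) u =
      (\<Sum>i\<le>k. u (Suc i) * (pd i F u * G u + pd i G u * F u))"
    using Dx_eq_sum[OF assms(1) _ assms(2) order_refl, of k]
    by (simp add: smooth_function_def[of k S "\<lambda>u. F u * G u"] pd_mult[OF k assms(2)])
  also have "\<dots> = (\<Sum>i\<le>k. u (Suc i) * pd i F u) * G u + F u * (\<Sum>i\<le>k. u (Suc i) * pd i G u)"
    by (simp add: sum_distrib_left sum_distrib_right sum.distrib [symmetric] algebra_simps)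
  also have "\<dots> = Dx F u * G u + F u * Dx G u"
    using k Dx_eq_sum[OF assms(1) _ assms(2) order_refl, of k] by (simp add: smooth_function_def)
  finally show ?thesis .
qed

lemma Dx_minus:
  assumes "open S" "u \<in> S" "jet_smooth S F"
  shows "Dx (\<lambda>u. - F u) u = - Dx F u"
  using Dx_mult[OF assms(1,2) jet_smooth_const[of S "-1"] assms(3)] by simp

lemma Dx_diff:
  assumes "open S" "u \<in> S" "jet_smooth S F" "jet_smooth S G"
  shows "Dx (\<lambda>u. F u - G u) u = Dx F u - Dx G u"
  using Dx_add[OF assms(1-3) jet_smooth_minus[OF assms(1,4)]] Dx_minus[OF assms(1,2,4)] by simp

lemma Dx_divide:
  assumes "open S" "u \<in> S" "jet_smooth S F"
  shows "Dx (\<lambda>u. F u / c) u = Dx F u / c"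
  using Dx_mult[OF assms jet_smooth_const[of S "inverse c"]] by (simp add: divide_inverse)

lemma Dx_power2:
  assumes "open S" "u \<in> S" "jet_smooth S F"
  shows "Dx (\<lambda>u. (F u)\<^sup>2) u = 2 * F u * Dx F u"
  using Dx_mult[OF assms assms(3)] by (simp add: power2_eq_square)

lemmas Dx_rules = Dx_add Dx_mult Dx_minus Dx_diff Dx_divide Dx_power2

lemma Dt_affine:
  "Dt (\<lambda>u. p * u 0 + q * u 2 + r) u v = p * v 0 + q * v 2"
proof -
  have pd: "pd i (\<lambda>u. p * u 0 + q * u 2 + r) u = (if i = 0 then p else if i = 2 then q else 0)" for i
    by (rule pd_eqI) (auto intro!: derivative_eq_intros)
  have "Dt (\<lambda>u. p * u 0 + q * u 2 + r) u v =
      (\<Sum>i\<in>{0, 2}. v i * pd i (\<lambda>u. p * u 0 + q * u 2 + r) u)"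
    unfolding Dt_def by (rule sum.mono_neutral_left) (auto simp: pd split: if_splits)
  then show ?thesis
    by (simp add: pd)
qed

text \<open>By continuity the nonzero set of \<open>F\<close> is open in \<open>S\<close>, so a
  single nonzero value suffices.\<close>

lemma generically_nonzero_iff:
  assumes "open S" "continuous_on S F"
  shows "generically_nonzero S F \<longleftrightarrow> (\<exists>u\<in>S. F u \<noteq> 0)"
proof
  assume "\<exists>u\<in>S. F u \<noteq> 0"
  moreover have "open (S \<inter> F -` (- {0}))"
    using assms by (intro continuous_open_preimage) auto
  ultimately show "generically_nonzero S F"
    unfolding generically_nonzero_def by (intro exI[of _ "S \<inter> F -` (- {0})"]) auto
qed (auto simp: generically_nonzero_def)

section \<open>Lowering the order of a function\<close>

lemma convex_jets_over:
  assumes "convex U" "u \<in> jets_over U" "v \<in> jets_over U" "0 \<le> s" "s \<le> 1"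
  shows "(\<lambda>i. (1 - s) * u i + s * v i) \<in> jets_over U"
  using convexD[OF assms(1), of "(u 0, u 1, u 2)" "(v 0, v 1, v 2)" "1 - s" s] assms(2-5)
  by (simp add: jets_over_def)

text \<open>
  Along the segment from \<open>u\<close> to \<open>v\<close> only the coordinate \<open>N\<close> matters, because the lower ones agree
  and \<open>F\<close> ignores the higher ones. Convexity keeps the segment inside the domain.
\<close>

lemma pd_eq_0_imp_eq:
  assumes U: "open U" "convex U"
    and F: "smooth_function N (jets_over U) F"
    and pd0: "\<And>u. u \<in> jets_over U \<Longrightarrow> pd N F u = 0"
    and u: "u \<in> jets_over U" and v: "v \<in> jets_over U"
    and uv: "\<And>i. i < N \<Longrightarrow> u i = v i"
  shows "F u = F v"
proof -
  define w where "w s = (\<lambda>i. (1 - s) * u i + s * v i)" for s :: real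
  let ?S = "jets_over U"
  have S: "open ?S"
    using U(1) by (rule open_jets_over)
  have w_in: "w s \<in> ?S" if "0 \<le> s" "s \<le> 1" for s
    unfolding w_def using convex_jets_over[OF U(2) u v that] .
  have dep: "depends_upto N ?S F"
    using F by (simp add: smooth_function_def)
  have "((\<lambda>s. F (w s)) has_field_derivative 0) (at s within {0..1})" if s: "s \<in> {0..1}" for s
  proof -
    let ?p = "\<lambda>r. (w s)(N := r)"
    have in_S: "w s \<in> ?S"
      using w_in s by auto
    have "((\<lambda>r. F (?p r)) has_field_derivative 0) (at (w s N))"
      using smooth_function_has_pd[OF F in_S, of N] pd0[OF in_S] by simp
    moreover have wN: "((\<lambda>r. w r N) has_field_derivative v N - u N) (at s within {0..1})"
      unfolding w_def by (auto intro!: derivative_eq_intros)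
    ultimately have D: "((\<lambda>r. F (?p (w r N))) has_field_derivative 0) (at s within {0..1})"
      using DERIV_chain2[of "\<lambda>r. F (?p r)" 0 "\<lambda>r. w r N" s "v N - u N" "{0..1}"] by simp
    have "continuous (at s within {0..1}) (\<lambda>r. w r N)"
      using wN by (rule DERIV_continuous)
    then have "filterlim (\<lambda>r. w r N) (nhds (w s N)) (at s within {0..1})"
      by (simp add: continuous_within)
    then have "eventually (\<lambda>r. ?p (w r N) \<in> ?S) (at s within {0..1})"
      using eventually_upd_in[OF S in_S, of N] unfolding filterlim_iff by blast
    then have "eventually (\<lambda>r. F (?p (w r N)) = F (w r)) (at s within {0..1})"
    proof (rule eventually_elim2)
      show "eventually (\<lambda>r. r \<in> {0..1}) (at s within {0..1})"
        by (simp add: eventually_at_filter)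
    next
      fix r assume r: "?p (w r N) \<in> ?S" "r \<in> {0..1}"
      show "F (?p (w r N)) = F (w r)"
      proof (rule depends_uptoD[OF dep r(1)])
        show "w r \<in> ?S"
          using r(2) w_in by auto
        show "(?p (w r N)) i = w r i" if "i \<le> N" for i
          using that uv[of i] by (auto simp: w_def algebra_simps)
      qed
    qed
    then show ?thesis
      using s unfolding has_field_derivative_def
      by (intro has_derivative_transform_eventually[OF D[unfolded has_field_derivative_def]]) auto
  qed
  then have "F (w 0) = F (w 1)"
    using has_field_derivative_zero_constant[of "{0..1}" "\<lambda>s. F (w s)"]
    by (metis atLeastAtMost_iff convex_real_interval(5) order_refl zero_le_one)
  then show ?thesis
    by (simp add: w_def)
qed

text \<open>
  \<open>Dx F\<close> is affine in \<open>z\<^sub>N\<^sub>+\<^sub>1\<close> with slope \<open>\<partial>F/\<partial>z\<^sub>N\<close>, which must vanish if \<open>Dx F\<close> has order at most \<open>N\<close>.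
\<close>

lemma Dx_order_drop:
  assumes U: "open U" "convex U"
    and F: "smooth_function N (jets_over U) F"
    and R: "depends_upto N (jets_over U) R"
    and eq: "\<And>u. u \<in> jets_over U \<Longrightarrow> Dx F u = R u"
    and u: "u \<in> jets_over U" and v: "v \<in> jets_over U"
    and uv: "\<And>i. i < N \<Longrightarrow> u i = v i"
  shows "F u = F v"
proof (rule pd_eq_0_imp_eq[OF U F _ u v uv])
  let ?S = "jets_over U"
  have S: "open ?S"
    using U(1) by (rule open_jets_over)
  have dep: "depends_upto N ?S F"
    using F by (simp add: smooth_function_def)
  fix w assume w: "w \<in> ?S"
  obtain s where s: "w(Suc N := s) \<in> ?S" "s \<noteq> w (Suc N)"
    using exists_other_upd_in[OF S w] .
  have pd: "pd i F (w(Suc N := s)) = pd i F w" for i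
    by (rule depends_uptoD[OF depends_upto_pd[OF S dep] s(1) w]) auto
  have "Dx F (w(Suc N := s)) = Dx F w"
    unfolding eq[OF w] eq[OF s(1)] by (rule depends_uptoD[OF R s(1) w]) auto
  moreover have "Dx F (w(Suc N := s)) - Dx F w = (s - w (Suc N)) * pd N F w"
    unfolding Dx_eq_sum[OF S dep w order_refl] Dx_eq_sum[OF S dep s(1) order_refl] pd
      sum_subtractf[symmetric]
    by (subst sum.mono_neutral_right[of _ "{N}"]) (auto simp: algebra_simps)
  ultimately show "pd N F w = 0"
    using s(2) by simp
qed

text \<open>Agreement below \<open>Suc N\<close> is agreement up to \<open>N\<close>, so
  \<open>Dx_order_drop\<close> lowers the order of \<open>F\<close> by one. This is the descent step
  of the order reductions.\<close>

lemma Dx_order_drop_Suc: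
  assumes "open U" "convex U"
    and F: "smooth_function (Suc N) (jets_over U) F"
    and R: "depends_upto (Suc N) (jets_over U) R"
    and "\<And>u. u \<in> jets_over U \<Longrightarrow> Dx F u = R u"
  shows "smooth_function N (jets_over U) F"
proof -
  have "depends_upto N (jets_over U) F"
    by (rule depends_uptoI, rule Dx_order_drop[OF assms]) auto
  then show ?thesis
    using F by (simp add: smooth_function_def)
qed

section \<open>The structure equations as identities on jets\<close>

text \<open>Being affine in \<open>t\<close>, such a function has at \<open>t = 0\<close> the
  x-derivatives of \<open>p\<close>, while the x-derivatives of its t-derivative are those of
  \<open>q\<close>; the two families can be prescribed independently.\<close>

definition poly_plane :: "real poly \<Rightarrow> real poly \<Rightarrow> real \<Rightarrow> real \<Rightarrow> real" where
  "poly_plane p q = (\<lambda>x t. poly p x + t * poly q x)"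

lemma has_derivative_poly_plane:
  "((\<lambda>s. poly_plane p q s t) has_field_derivative poly (pderiv p) x + t * poly (pderiv q) x) (at x)"
  "((\<lambda>s. poly_plane p q x s) has_field_derivative poly q x) (at t)"
  unfolding poly_plane_def by (auto intro!: derivative_eq_intros poly_DERIV)

lemma dx_poly_plane: "dx (poly_plane p q) = poly_plane (pderiv p) (pderiv q)"
  by (intro ext, unfold dx_def, subst DERIV_imp_deriv[OF has_derivative_poly_plane(1)])
    (simp add: poly_plane_def)

lemma dt_poly_plane: "dt (poly_plane p q) = poly_plane q 0"
  by (intro ext, unfold dt_def, subst DERIV_imp_deriv[OF has_derivative_poly_plane(2)])
    (simp add: poly_plane_def)

lemma dx_funpow_poly_plane:
  "(dx ^^ i) (poly_plane p q) = poly_plane ((pderiv ^^ i) p) ((pderiv ^^ i) q)"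
  by (induction i) (simp_all add: dx_poly_plane)

lemma smooth_plane_poly_plane: "smooth_plane D (poly_plane p q)"
proof -
  have cont: "continuous_on D (\<lambda>(x, t). poly_plane p q x t)" for p q
    unfolding poly_plane_def case_prod_beta by (intro continuous_intros)
  have "Ck_plane n D (poly_plane p q)" for n
  proof (induction n arbitrary: p q)
    case (Suc n)
    have "(\<lambda>s. poly_plane p q s t) differentiable at x" "poly_plane p q x differentiable at t" for x t
      unfolding real_differentiable_def by (intro exI, rule has_derivative_poly_plane)+
    with Suc cont show ?case
      by (auto simp: dx_poly_plane dt_poly_plane)
  qed (simp add: cont)
  then show ?thesis
    by (simp add: smooth_plane_def)
qed

text \<open>Taylor polynomials with coefficients \<open>u i / fact i\<close> and
  \<open>v i / fact i\<close> realize the prescribed values at the origin.\<close>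

lemma exists_plane_with_jet:
  obtains z where "smooth_plane UNIV z"
    "\<And>i. i \<le> K \<Longrightarrow> xjet z 0 0 i = u i" "\<And>i. i \<le> K \<Longrightarrow> xjet_t z 0 0 i = v i"
proof -
  define P where "P u = (\<Sum>i\<le>K. monom (u i / fact i) i)" for u :: jet
  have coeff: "coeff (P u) i = u i / fact i" if "i \<le> K" for u i
    using that by (simp add: P_def coeff_sum)
  have P: "poly ((pderiv ^^ i) (P u)) 0 = u i" if "i \<le> K" for u i
    by (simp add: poly_0_coeff_0 coeff_higher_pderiv coeff[OF that] pochhammer_fact[symmetric])
  show thesis
  proof (rule that[of "poly_plane (P u) (P v)"])
    show "smooth_plane UNIV (poly_plane (P u) (P v))"
      by (rule smooth_plane_poly_plane)
  qed (simp_all add: xjet_def xjet_t_def dx_funpow_poly_plane dt_poly_plane, simp_all add: poly_plane_def P)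
qed

definition smooth_forms :: "jet set \<Rightarrow> (nat \<Rightarrow> nat \<Rightarrow> jet \<Rightarrow> real) \<Rightarrow> bool" where
  "smooth_forms S f \<longleftrightarrow> (\<exists>k. \<forall>i\<in>{1, 2, 3}. \<forall>j\<in>{1, 2}. smooth_function k S (f i j))"

text \<open>The maximum of the six individual orders serves as the common one.\<close>

lemma smooth_forms_iff:
  "smooth_forms S f \<longleftrightarrow> (\<forall>i\<in>{1, 2, 3}. \<forall>j\<in>{1, 2}. jet_smooth S (f i j))"
proof
  assume smooth: "\<forall>i\<in>{1, 2, 3}. \<forall>j\<in>{1, 2}. jet_smooth S (f i j)"
  define k where "k i j = (SOME k. smooth_function k S (f i j))" for i j
  let ?K = "Max ((\<lambda>(i, j). k i j) ` ({1, 2, 3} \<times> {1, 2}))"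
  have "smooth_function ?K S (f i j)" if "i \<in> {1, 2, 3}" "j \<in> {1, 2}" for i j
  proof (rule smooth_function_mono)
    have "\<exists>k. smooth_function k S (f i j)"
      using smooth that unfolding jet_smooth_def by blast
    then show "smooth_function (k i j) S (f i j)"
      unfolding k_def by (rule someI_ex)
    show "k i j \<le> ?K"
      using that by (intro Max_ge) auto
  qed
  then show "smooth_forms S f"
    unfolding smooth_forms_def by blast
qed (auto simp: smooth_forms_def jet_smooth_def)

text \<open>The solution \<open>z\<close> is gone: the jet \<open>u\<close> and the list
  \<open>v\<close> of t-derivatives vary independently. The condition on the wedge product is kept
  apart, because coefficients in form (I) may violate it.\<close>

definition pointwise_describes ::
  "real \<Rightarrow> jet set \<Rightarrow> (jet \<Rightarrow> real) \<Rightarrow> (jet \<Rightarrow> real) \<Rightarrow> (nat \<Rightarrow> nat \<Rightarrow> jet \<Rightarrow> real) \<Rightarrow> bool" where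
  "pointwise_describes \<delta> S A B f \<longleftrightarrow> smooth_forms S f \<and>
     (\<forall>u\<in>S. \<forall>v. v 2 = A u * u 3 + B u \<longleftrightarrow> structure_equations \<delta> f u v)"

text \<open>\<open>Dx\<close> reads one coordinate more than the order of its argument, hence
  \<open>Suc k\<close> for \<open>u\<close>; \<open>Dt\<close> reads \<open>v\<close> only up to
  \<open>k\<close>.\<close>

lemma structure_equations_cong_jet:
  assumes S: "open S" and f: "\<forall>i\<in>{1, 2, 3}. \<forall>j\<in>{1, 2}. smooth_function k S (f i j)"
    and uw: "u \<in> S" "w \<in> S" "\<And>i. i \<le> Suc k \<Longrightarrow> u i = w i" "\<And>i. i \<le> k \<Longrightarrow> v i = y i"
  shows "structure_equations \<delta> f u v \<longleftrightarrow> structure_equations \<delta> f w y"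
proof -
  have dep: "depends_upto k S (f i j)" if "i \<in> {1, 2, 3}" "j \<in> {1, 2}" for i j
    using f that unfolding smooth_function_def by blast
  have f_eq: "f i j u = f i j w" if "i \<in> {1, 2, 3}" "j \<in> {1, 2}" for i j
    using depends_uptoD[OF dep[OF that] uw(1,2)] uw(3) by auto
  have pd_eq: "pd l (f i j) u = pd l (f i j) w" if "i \<in> {1, 2, 3}" "j \<in> {1, 2}" for i j l
    using depends_uptoD[OF depends_upto_pd[OF S dep[OF that]] uw(1,2)] uw(3) by auto
  have "Dx (f i j) u = Dx (f i j) w" "Dt (f i j) u v = Dt (f i j) w y"
    if "i \<in> {1, 2, 3}" "j \<in> {1, 2}" for i j
    using uw(3,4)
    by (simp_all add: Dx_eq_sum[OF S dep[OF that] uw(1) order_refl] pd_eq[OF that]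
        Dx_eq_sum[OF S dep[OF that] uw(2) order_refl] Dt_eq_sum[OF S dep[OF that] uw(1) order_refl]
        Dt_eq_sum[OF S dep[OF that] uw(2) order_refl])
  then show ?thesis
    by (simp add: structure_equations_def ext_d_def wedge_def f_eq)
qed

text \<open>Both sides of the equivalence see only finitely many coordinates, and any finite part of
  a pair \<open>u\<close>, \<open>v\<close> occurs at the origin for some smooth \<open>z\<close>.
  Conversely, \<open>u\<close> and \<open>v\<close> are specialized to the jets of
  \<open>z\<close>.\<close>

lemma describes_iff_pointwise:
  assumes U: "open U"
    and A: "smooth_function 2 (jets_over U) A" and B: "smooth_function 2 (jets_over U) B"
  shows "describes \<delta> (jets_over U) A B f \<longleftrightarrow>
    pointwise_describes \<delta> (jets_over U) A B f \<and> generically_nonzero (jets_over U) (wedge f 1 2)"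
proof -
  let ?S = "jets_over U"
  have S: "open ?S"
    using U by (rule open_jets_over)
  define sol where "sol z x t \<longleftrightarrow>
      (dt ((dx ^^ 2) z) x t = A (xjet z x t) * (dx ^^ 3) z x t + B (xjet z x t) \<longleftrightarrow>
        structure_equations \<delta> f (xjet z x t) (xjet_t z x t))" for z x t
  have sol_iff: "sol z x t \<longleftrightarrow> (xjet_t z x t 2 = A (xjet z x t) * xjet z x t 3 + B (xjet z x t) \<longleftrightarrow>
      structure_equations \<delta> f (xjet z x t) (xjet_t z x t))" for z x t
    by (simp add: sol_def xjet_def xjet_t_def)
  have "(\<forall>D z. open D \<and> smooth_plane D z \<longrightarrow> (\<forall>(x, t)\<in>D. xjet z x t \<in> ?S \<longrightarrow> sol z x t)) \<longleftrightarrow>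
      (\<forall>u\<in>?S. \<forall>v. v 2 = A u * u 3 + B u \<longleftrightarrow> structure_equations \<delta> f u v)" (is "?L \<longleftrightarrow> ?R")
    if forms: "smooth_forms ?S f"
  proof
    assume ?L
    obtain k where k: "\<forall>i\<in>{1, 2, 3}. \<forall>j\<in>{1, 2}. smooth_function k ?S (f i j)"
      using forms unfolding smooth_forms_def by blast
    show ?R
    proof (intro ballI allI)
      fix u v assume u: "u \<in> ?S"
      \<comment> \<open>Order \<open>k + 3\<close> covers the index \<open>Suc k\<close> needed by
        the structure equations as well as the indices 3 and 2 in the equation itself.\<close>
      obtain z where z: "smooth_plane UNIV z" "\<And>i. i \<le> k + 3 \<Longrightarrow> xjet z 0 0 i = u i"
        "\<And>i. i \<le> k + 3 \<Longrightarrow> xjet_t z 0 0 i = v i"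
        using exists_plane_with_jet[of "k + 3" u v] by blast
      have z_in: "xjet z 0 0 \<in> ?S"
        using u z(2) by (simp add: jets_over_def)
      have "A (xjet z 0 0) = A u"
        by (rule depends_uptoD[of 2 ?S]) (use A z u z_in in \<open>auto simp: smooth_function_def\<close>)
      moreover have "B (xjet z 0 0) = B u"
        by (rule depends_uptoD[of 2 ?S]) (use B z u z_in in \<open>auto simp: smooth_function_def\<close>)
      moreover have "structure_equations \<delta> f (xjet z 0 0) (xjet_t z 0 0) \<longleftrightarrow>
          structure_equations \<delta> f u v"
        by (rule structure_equations_cong_jet[OF S k]) (use z u z_in in auto)
      moreover have "sol z 0 0"
        using \<open>?L\<close> z(1) z_in by blast
      ultimately show "v 2 = A u * u 3 + B u \<longleftrightarrow> structure_equations \<delta> f u v"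
        using z(2)[of 3] z(3)[of 2] by (simp add: sol_iff)
    qed
  qed (auto simp: sol_iff)
  note pointwise = this[unfolded sol_def]
  show ?thesis
    unfolding describes_def pointwise_describes_def smooth_forms_def[symmetric]
    using pointwise by (cases "smooth_forms ?S f") (simp_all only: simp_thms)
qed

section \<open>Invariance under linear coordinate transformations\<close>

lemma old_jet_upd:
  "old_jet a c c0 (u(i := s)) =
    (old_jet a c c0 u)(i := a ^ i * (s - (if i = 0 then c0 else 0)) / c)"
  by (auto simp: old_jet_def)

lemma continuous_on_old_jet: "continuous_on UNIV (old_jet a c c0)"
  unfolding old_jet_def divide_inverse
  by (intro continuous_on_coordinatewise_then_product continuous_on_mult continuous_on_diff
      continuous_on_const continuous_on_product_coordinates)

lemma open_transform_dom: "open S \<Longrightarrow> open (transform_dom a c c0 S)"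
  using open_vimage[OF _ continuous_on_old_jet] by (simp add: transform_dom_def vimage_def)

lemma has_pd_old_jet:
  assumes "((\<lambda>s. F ((old_jet a c c0 u)(i := s))) has_field_derivative D) (at (old_jet a c c0 u i))"
  shows "((\<lambda>s. F (old_jet a c c0 (u(i := s)))) has_field_derivative a ^ i / c * D) (at (u i))"
proof -
  let ?g = "\<lambda>s. a ^ i * (s - (if i = 0 then c0 else 0)) / c"
  have "(?g has_field_derivative a ^ i / c) (at (u i))"
    by (auto intro!: derivative_eq_intros simp: divide_inverse)
  moreover have "old_jet a c c0 u i = ?g (u i)"
    by (simp add: old_jet_def)
  ultimately show ?thesis
    using DERIV_chain2[of "\<lambda>s. F ((old_jet a c c0 u)(i := s))" D ?g "u i" "a ^ i / c" UNIV] assms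
    by (simp add: old_jet_upd mult.commute)
qed

lemma Ck_on_old_jet:
  assumes "open S" "Ck_on n S F"
  shows "Ck_on n (transform_dom a c c0 S) (\<lambda>u. F (old_jet a c c0 u))"
  using assms(2)
proof (induction n arbitrary: F)
  case 0
  then show ?case
    using continuous_on_compose2[OF _ continuous_on_subset[OF continuous_on_old_jet], of S F]
    by (auto simp: transform_dom_def image_subset_iff)
next
  case (Suc n)
  let ?T = "transform_dom a c c0 S"
  have T: "open ?T"
    using assms(1) by (rule open_transform_dom)
  have D: "((\<lambda>s. F (old_jet a c c0 (u(i := s)))) has_field_derivative
      a ^ i / c * pd i F (old_jet a c c0 u)) (at (u i))" if "u \<in> ?T" for u i
    by (rule has_pd_old_jet, rule Ck_on_has_pd[OF Suc.prems]) (use that in \<open>simp add: transform_dom_def\<close>)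
  have "Ck_on n ?T (pd i (\<lambda>u. F (old_jet a c c0 u)))" for i
  proof (rule Ck_on_cong[OF T])
    show "Ck_on n ?T (\<lambda>u. a ^ i / c * pd i F (old_jet a c c0 u))"
      using Suc by (intro Ck_on_mult[OF T] Ck_on_const) auto
  qed (simp add: pd_eqI[OF D])
  moreover have "continuous_on ?T (\<lambda>u. F (old_jet a c c0 u))"
    using continuous_on_compose2[OF _ continuous_on_subset[OF continuous_on_old_jet], of S F]
      Ck_on_imp_continuous_on[OF Suc.prems] by (auto simp: transform_dom_def image_subset_iff)
  moreover have "\<forall>u\<in>?T. (\<lambda>s. F (old_jet a c c0 (u(i := s)))) differentiable (at (u i))" for i
    using D by (auto simp: real_differentiable_def)
  ultimately show ?case
    by simp
qed

lemma smooth_function_old_jet: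
  assumes "open S" "smooth_function k S F"
  shows "smooth_function k (transform_dom a c c0 S) (\<lambda>u. F (old_jet a c c0 u))"
proof -
  have dep: "depends_upto k S F"
    using assms by (simp add: smooth_function_def)
  have "depends_upto k (transform_dom a c c0 S) (\<lambda>u. F (old_jet a c c0 u))"
    by (rule depends_uptoI, rule depends_uptoD[OF dep]) (auto simp: transform_dom_def old_jet_def)
  then show ?thesis
    using assms Ck_on_old_jet by (simp add: smooth_function_def)
qed

lemma transform_dom_jets_over:
  "transform_dom a c c0 (jets_over U) =
    jets_over ((\<lambda>(x, y, z). ((x - c0) / c, a * y / c, a\<^sup>2 * z / c)) -` U)"
  by (auto simp: transform_dom_def jets_over_def old_jet_def)

text \<open>\<open>new\<close> and the abbreviations ending in \<open>_inv\<close> belong to the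
  inverse transformation: solving for the old \<open>z\<close> gives the factor \<open>1 / c\<close>
  and the shift \<open>- (c0 / c)\<close>.\<close>

locale coordinate_transformation =
  fixes a b c c0 :: real
  assumes nonzero: "a \<noteq> 0" "b \<noteq> 0" "c \<noteq> 0"
begin

abbreviation "dom' \<equiv> transform_dom a c c0"
abbreviation "A' \<equiv> transform_A a b c c0"
abbreviation "B' \<equiv> transform_B a b c c0"
abbreviation "forms' \<equiv> transform_forms a b c c0"
abbreviation "old \<equiv> old_jet a c c0"
abbreviation "dom_inv \<equiv> transform_dom (1 / a) (1 / c) (- (c0 / c))"
abbreviation "A_inv \<equiv> transform_A (1 / a) (1 / b) (1 / c) (- (c0 / c))"
abbreviation "B_inv \<equiv> transform_B (1 / a) (1 / b) (1 / c) (- (c0 / c))"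
abbreviation "forms_inv \<equiv> transform_forms (1 / a) (1 / b) (1 / c) (- (c0 / c))"
abbreviation "new \<equiv> old_jet (1 / a) (1 / c) (- (c0 / c))"

lemma inverse: "coordinate_transformation (1 / a) (1 / b) (1 / c)"
  using nonzero by unfold_locales auto

lemma old_new [simp]: "old (new u) = u"
  using nonzero by (auto simp: old_jet_def field_simps)

lemma new_old [simp]: "new (old u) = u"
  using nonzero by (auto simp: old_jet_def field_simps)

lemma dom_inv_dom: "dom_inv (dom' S) = S"
  by (auto simp: transform_dom_def)

lemma A_inv_A: "A_inv (A' F) = F"
  using nonzero by (auto simp: transform_A_def)

lemma B_inv_B: "B_inv (B' F) = F"
  using nonzero by (auto simp: transform_B_def field_simps power2_eq_square)

lemma forms_inv_forms: "forms_inv (forms' f) = f"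
  using nonzero by (intro ext) (auto simp: transform_forms_def)

lemma forms_forms_inv [simp]: "forms' (forms_inv f) = f"
  using nonzero by (intro ext) (auto simp: transform_forms_def)

lemma pd_old:
  assumes "jet_smooth S F" "old u \<in> S"
  shows "pd i (\<lambda>u. F (old u)) u = a ^ i / c * pd i F (old u)"
proof -
  obtain k where "smooth_function k S F"
    using assms unfolding jet_smooth_def by blast
  from has_pd_old_jet[OF smooth_function_has_pd[OF this assms(2)]] show ?thesis
    by (rule pd_eqI)
qed

lemma Dx_old:
  assumes "jet_smooth S F" "old u \<in> S"
  shows "Dx (\<lambda>u. F (old u)) u = Dx F (old u) / a"
  unfolding Dx_def pd_old[OF assms] using nonzero
  by (auto simp: sum_divide_distrib old_jet_def intro!: sum.cong)

lemma Dt_old: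
  assumes "jet_smooth S F" "old u \<in> S"
  shows "Dt (\<lambda>u. F (old u)) u v = Dt F (old u) (\<lambda>i. a ^ i * v i / c)"
  unfolding Dt_def pd_old[OF assms] using nonzero by (simp add: mult.assoc mult.left_commute)

lemma pd_scale:
  assumes "jet_smooth S F" "u \<in> S"
  shows "pd i (\<lambda>u. k * F u) u = k * pd i F u"
proof -
  obtain l where "smooth_function l S F"
    using assms unfolding jet_smooth_def by blast
  from pd_mult[OF smooth_function_const[of 0 S k] this assms(2)] show ?thesis
    by (simp add: pd_def)
qed

lemma Dx_scale:
  assumes "jet_smooth S F" "u \<in> S"
  shows "Dx (\<lambda>u. k * F u) u = k * Dx F u"
  by (cases "k = 0") (simp_all add: Dx_def pd_scale[OF assms] sum_distrib_left mult.left_commute)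

lemma Dt_scale:
  assumes "jet_smooth S F" "u \<in> S"
  shows "Dt (\<lambda>u. k * F u) u v = k * Dt F u v"
  by (cases "k = 0") (simp_all add: Dt_def pd_scale[OF assms] sum_distrib_left mult.left_commute)

lemma smooth_forms_transform:
  assumes S: "open S" and f: "smooth_forms S f"
  shows "smooth_forms (dom' S) (forms' f)"
proof -
  obtain k where k: "\<forall>i\<in>{1, 2, 3}. \<forall>j\<in>{1, 2}. smooth_function k S (f i j)"
    using f unfolding smooth_forms_def by blast
  have "smooth_function k (dom' S) (forms' f i j)" if "i \<in> {1, 2, 3}" "j \<in> {1, 2}" for i j
    unfolding transform_forms_def
    by (intro smooth_function_mult smooth_function_const smooth_function_old_jet open_transform_dom S)
      (use k that in blast)
  then show ?thesis
    unfolding smooth_forms_def by blast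
qed

text \<open>Everything is homogeneous: \<open>ext_d\<close> and \<open>wedge\<close> both acquire
  the factor \<open>1 / (a * b)\<close>, the equation acquires \<open>c / (a\<^sup>2 * b)\<close>.
  These are nonzero, so the equivalence at \<open>old u\<close> carries over to
  \<open>u\<close>.\<close>

lemma pointwise_describes_transform:
  assumes S: "open S" and d: "pointwise_describes \<delta> S A B f"
  shows "pointwise_describes \<delta> (dom' S) (A' A) (B' B) (forms' f)"
  unfolding pointwise_describes_def
proof (intro conjI ballI allI)
  have sm: "smooth_forms S f"
    using d by (simp add: pointwise_describes_def)
  then show "smooth_forms (dom' S) (forms' f)"
    by (rule smooth_forms_transform[OF S])
  fix u v assume u: "u \<in> dom' S"
  then have w: "old u \<in> S"
    by (simp add: transform_dom_def)
  \<comment> \<open>The old t-derivatives: the change of \<open>t\<close> contributes the factor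
    \<open>b\<close>, and the shift \<open>c0\<close> disappears under differentiation.\<close>
  let ?y = "\<lambda>i. b * (a ^ i * v i / c)"
  have js: "jet_smooth S (f i 1)" "jet_smooth S (f i 2)" if "i \<in> {1, 2, 3}" for i
    using sm that unfolding smooth_forms_iff by blast+
  have js': "jet_smooth (dom' S) (\<lambda>u. f i 1 (old u))" "jet_smooth (dom' S) (\<lambda>u. f i 2 (old u))"
    if "i \<in> {1, 2, 3}" for i
    using js[OF that] smooth_function_old_jet[OF S] unfolding jet_smooth_def by blast+
  have Dt_b: "Dt F w (\<lambda>i. b * v i) = b * Dt F w v" for F w v
    by (simp add: Dt_def sum_distrib_left mult.assoc)
  have ext: "ext_d (forms' f) i u v = 1 / (a * b) * ext_d f i (old u) ?y" if i: "i \<in> {1, 2, 3}" for i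
  proof -
    have "Dx (forms' f i 2) u = 1 / b * (Dx (f i 2) (old u) / a)"
      unfolding Dx_old[OF js(2)[OF i] w, symmetric]
      by (subst Dx_scale[OF js'(2)[OF i] u, symmetric]) (simp_all add: transform_forms_def[abs_def])
    moreover have "Dt (forms' f i 1) u v = 1 / a * Dt (f i 1) (old u) (\<lambda>i. a ^ i * v i / c)"
      unfolding Dt_old[OF js(1)[OF i] w, symmetric]
      by (subst Dt_scale[OF js'(1)[OF i] u, symmetric]) (simp_all add: transform_forms_def[abs_def])
    ultimately show ?thesis
      using nonzero unfolding ext_d_def Dt_b by (simp add: field_simps)
  qed
  have wedge: "wedge (forms' f) i j u = 1 / (a * b) * wedge f i j (old u)" for i j
    using nonzero by (simp add: wedge_def transform_forms_def field_simps)
  have "structure_equations \<delta> (forms' f) u v \<longleftrightarrow> structure_equations \<delta> f (old u) ?y"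
    using nonzero by (simp add: structure_equations_def ext wedge)
  also have "\<dots> \<longleftrightarrow> ?y 2 = A (old u) * old u 3 + B (old u)"
  proof -
    have "\<forall>v. v 2 = A (old u) * old u 3 + B (old u) \<longleftrightarrow> structure_equations \<delta> f (old u) v"
      using d w by (simp add: pointwise_describes_def)
    from spec[OF this, of ?y] show ?thesis
      by (rule sym)
  qed
  also have "\<dots> \<longleftrightarrow> v 2 = A' A u * u 3 + B' B u"
  proof -
    let ?k = "c / (a\<^sup>2 * b)"
    have "a / b * u 3 = ?k * old u 3"
      using nonzero by (simp add: old_jet_def power2_eq_square power3_eq_cube)
    then have "A' A u * u 3 = A (old u) * (?k * old u 3)"
      unfolding transform_A_def by (metis mult.assoc mult.commute)
    then have "A' A u * u 3 + B' B u = ?k * (A (old u) * old u 3 + B (old u))"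
      by (simp only: transform_B_def distrib_left mult.left_commute)
    moreover have "v 2 = ?k * ?y 2"
      using nonzero by simp
    moreover have "?k \<noteq> 0"
      using nonzero by simp
    ultimately show ?thesis
      by (metis (no_types, lifting) mult_left_cancel)
  qed
  finally show "v 2 = A' A u * u 3 + B' B u \<longleftrightarrow> structure_equations \<delta> (forms' f) u v"
    by blast
qed

text \<open>The factor \<open>1 / a\<close> of the forms and \<open>a\<^sup>2 / c\<close> from the
  second derivative combine to \<open>a / c\<close> in both z_2-derivatives, so the quadratic
  condition is multiplied by a square. The shift \<open>c0\<close> affects only constant
  terms.\<close>

lemma conditions_f1_transform:
  assumes S: "open S" and sm: "smooth_forms S f" and c: "conditions_f1 \<delta> S f"
  shows "conditions_f1 \<delta> (dom' S) (forms' f)"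
proof -
  have affine: "\<exists>p q r. \<forall>u\<in>dom' S. forms' f i 1 u = p * u 0 + q * u 2 + r"
    if ex: "\<exists>p q r. \<forall>u\<in>S. f i 1 u = p * u 0 + q * u 2 + r" for i
  proof -
    obtain p q r where pqr: "\<forall>u\<in>S. f i 1 u = p * u 0 + q * u 2 + r"
      using ex by blast
    show ?thesis
    proof (intro exI ballI)
      fix u assume "u \<in> dom' S"
      then have "forms' f i 1 u = (p * old u 0 + q * old u 2 + r) / a"
        using pqr by (simp add: transform_dom_def transform_forms_def)
      also have "\<dots> = p / (a * c) * u 0 + q * a / c * u 2 + (r - p * c0 / c) / a"
        using nonzero
        by (simp add: old_jet_def add_divide_distrib diff_divide_distrib right_diff_distrib
            power2_eq_square mult.commute)
      finally show "forms' f i 1 u = p / (a * c) * u 0 + q * a / c * u 2 + (r - p * c0 / c) / a" .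
    qed
  qed
  have js: "jet_smooth S (f i 1)" if "i \<in> {2, 3}" for i
    using sm that unfolding smooth_forms_iff by blast
  have pd: "pd 2 (forms' f i 1) u = a / c * pd 2 (f i 1) (old u)"
    if "u \<in> dom' S" "i \<in> {2, 3}" for u i
  proof -
    have u: "old u \<in> S"
      using that by (simp add: transform_dom_def)
    have "jet_smooth (dom' S) (\<lambda>u. f i 1 (old u))"
      using js[OF that(2)] smooth_function_old_jet[OF S] unfolding jet_smooth_def by blast
    then have "pd 2 (\<lambda>u. 1 / a * f i 1 (old u)) u = 1 / a * (a\<^sup>2 / c * pd 2 (f i 1) (old u))"
      by (simp only: pd_scale that pd_old[OF js[OF that(2)] u])
    then show ?thesis
      using nonzero by (simp add: transform_forms_def[abs_def] power2_eq_square)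
  qed
  have "\<exists>\<eta>. \<forall>u\<in>dom' S. forms' f 1 1 u = \<eta>"
  proof -
    obtain \<eta> where "\<forall>u\<in>S. f 1 1 u = \<eta>"
      using c unfolding conditions_f1_def by blast
    then show ?thesis
      by (intro exI[of _ "\<eta> / a"]) (simp add: transform_dom_def transform_forms_def)
  qed
  moreover have "(pd 2 (forms' f 3 1) u)\<^sup>2 - \<delta> * (pd 2 (forms' f 2 1) u)\<^sup>2 = 0"
    if u: "u \<in> dom' S" for u
  proof -
    have "(pd 2 (forms' f 3 1) u)\<^sup>2 - \<delta> * (pd 2 (forms' f 2 1) u)\<^sup>2 =
        (a / c)\<^sup>2 * ((pd 2 (f 3 1) (old u))\<^sup>2 - \<delta> * (pd 2 (f 2 1) (old u))\<^sup>2)"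
      using pd[OF u] by (simp add: power_mult_distrib right_diff_distrib power_divide)
    also have "\<dots> = 0"
    proof -
      have "\<forall>u\<in>S. (pd 2 (f 3 1) u)\<^sup>2 - \<delta> * (pd 2 (f 2 1) u)\<^sup>2 = 0"
        using c unfolding conditions_f1_def by (elim conjE)
      then show ?thesis
        using u by (simp add: transform_dom_def)
    qed
    finally show ?thesis .
  qed
  moreover have "\<exists>p q r. \<forall>u\<in>S. f 2 1 u = p * u 0 + q * u 2 + r"
    "\<exists>p q r. \<forall>u\<in>S. f 3 1 u = p * u 0 + q * u 2 + r"
    using c by (simp_all only: conditions_f1_def)
  note this[THEN affine]
  ultimately show ?thesis
    unfolding conditions_f1_def by simp
qed

lemma wedge_transform: "wedge (forms' f) i j u = wedge f i j (old u) / (a * b)"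
  using nonzero by (simp add: wedge_def transform_forms_def field_simps)

end

declare One_nat_def [simp del]
declare One_nat_def [symmetric, simp]

lemma jet_smooth_cong:
  assumes "open S" "\<And>u. u \<in> S \<Longrightarrow> F u = G u" "jet_smooth S F"
  shows "jet_smooth S G"
  using assms(3) smooth_function_cong[of S F G] assms(1,2) unfolding jet_smooth_def by blast

lemma jet_smooth_imp_continuous_on: "jet_smooth S F \<Longrightarrow> continuous_on S F"
  unfolding jet_smooth_def using smooth_function_imp_continuous_on by blast

lemma smooth_formsD:
  assumes "smooth_forms S f"
  shows "jet_smooth S (f 1 1)" "jet_smooth S (f 2 1)" "jet_smooth S (f 3 1)"
    "jet_smooth S (f 1 2)" "jet_smooth S (f 2 2)" "jet_smooth S (f 3 2)"
  using assms by (simp_all add: smooth_forms_iff)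

lemma generically_nonzero_wedge_iff:
  assumes "open S" "smooth_forms S f"
  shows "generically_nonzero S (wedge f 1 2) \<longleftrightarrow> (\<exists>u\<in>S. wedge f 1 2 u \<noteq> 0)"
proof (rule generically_nonzero_iff[OF assms(1)])
  show "continuous_on S (wedge f 1 2)"
    unfolding wedge_def[abs_def]
    by (intro jet_smooth_imp_continuous_on jet_smooth_intros assms(1) smooth_formsD[OF assms(2)])
qed

section \<open>Forms with constant or affine dx-coefficients\<close>

text \<open>The shape to which \<open>standard_forms_exist\<close> reduces
  \<open>conditions_f1\<close>: no terms in z, and leading coefficients equal up to the sign
  \<epsilon>.\<close>

definition standard_forms ::
  "jet set \<Rightarrow> real \<Rightarrow> real \<Rightarrow> real \<Rightarrow> real \<Rightarrow> real \<Rightarrow> (nat \<Rightarrow> nat \<Rightarrow> jet \<Rightarrow> real) \<Rightarrow> bool" where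
  "standard_forms S \<epsilon> \<eta> q r s f \<longleftrightarrow>
     (\<forall>u\<in>S. f 1 1 u = \<eta> \<and> f 2 1 u = q * u 2 + r \<and> f 3 1 u = \<epsilon> * q * u 2 + s)"

lemma Dt_affine_on:
  assumes "open S" "\<And>u. u \<in> S \<Longrightarrow> F u = p * u 0 + q * u 2 + r" "u \<in> S"
  shows "Dt F u v = p * v 0 + q * v 2"
  using Dt_cong[of S F "\<lambda>u. p * u 0 + q * u 2 + r"] assms Dt_affine by simp

lemma pd_affine_on:
  assumes "open S" "\<And>u. u \<in> S \<Longrightarrow> F u = p * u 0 + q * u 2 + r" "u \<in> S"
  shows "pd 2 F u = q"
proof -
  have "pd 2 F u = pd 2 (\<lambda>u. p * u 0 + q * u 2 + r) u"
    by (rule pd_cong[OF assms])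
  also have "\<dots> = q"
    by (rule pd_eqI) (auto intro!: derivative_eq_intros)
  finally show ?thesis .
qed

lemma conditions_f1_standard:
  assumes S: "open S" and f: "standard_forms S \<epsilon> \<eta> q r s f" and \<epsilon>: "\<epsilon> \<in> {1, -1}"
  shows "conditions_f1 1 S f"
proof -
  have 1: "f 1 1 u = \<eta>" and 2: "f 2 1 u = 0 * u 0 + q * u 2 + r"
    and 3: "f 3 1 u = 0 * u 0 + \<epsilon> * q * u 2 + s" if "u \<in> S" for u
    using f that by (simp_all add: standard_forms_def)
  have "(pd 2 (f 3 1) u)\<^sup>2 - 1 * (pd 2 (f 2 1) u)\<^sup>2 = 0" if "u \<in> S" for u
    using pd_affine_on[of S "f 2 1", OF S 2 that] pd_affine_on[of S "f 3 1", OF S 3 that] \<epsilon> by auto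
  moreover have "\<exists>\<eta>. \<forall>u\<in>S. f 1 1 u = \<eta>"
    using 1 by blast
  moreover have "\<exists>p q r. \<forall>u\<in>S. f 2 1 u = p * u 0 + q * u 2 + r"
    using 2 by blast
  moreover have "\<exists>p q r. \<forall>u\<in>S. f 3 1 u = p * u 0 + q * u 2 + r"
    using 3 by blast
  ultimately show ?thesis
    unfolding conditions_f1_def by simp
qed

lemma structure_equations_standard:
  assumes S: "open S" and u: "u \<in> S" and f: "standard_forms S \<epsilon> \<eta> q r s f"
  shows "structure_equations 1 f u v \<longleftrightarrow>
    Dx (f 1 2) u = (\<epsilon> * q * u 2 + s) * f 2 2 u - f 3 2 u * (q * u 2 + r) \<and>
    Dx (f 2 2) u = q * v 2 + \<eta> * f 3 2 u - f 1 2 u * (\<epsilon> * q * u 2 + s) \<and>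
    Dx (f 3 2) u = \<epsilon> * q * v 2 + \<eta> * f 2 2 u - f 1 2 u * (q * u 2 + r)"
proof -
  have 1: "f 1 1 u = 0 * u 0 + 0 * u 2 + \<eta>" and 2: "f 2 1 u = 0 * u 0 + q * u 2 + r"
    and 3: "f 3 1 u = 0 * u 0 + \<epsilon> * q * u 2 + s" if "u \<in> S" for u
    using f that by (simp_all add: standard_forms_def)
  have "Dt (f 1 1) u v = 0" "Dt (f 2 1) u v = q * v 2" "Dt (f 3 1) u v = \<epsilon> * q * v 2"
    using Dt_affine_on[of S "f 1 1", OF S 1 u] Dt_affine_on[of S "f 2 1", OF S 2 u]
      Dt_affine_on[of S "f 3 1", OF S 3 u] by simp_all
  then show ?thesis
    unfolding structure_equations_def ext_d_def wedge_def 1[OF u] 2[OF u] 3[OF u]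
    by (intro iffI conjI; elim conjE; simp)
qed

text \<open>The structure equations contain \<open>v\<close> only through \<open>v 2\<close>, and
  since \<open>q \<noteq> 0\<close> the second one determines it. So the equivalence for all
  \<open>v\<close> amounts to the three equations with \<open>A u * u 3 + B u\<close> in place of
  \<open>v 2\<close>.\<close>

lemma pointwise_describes_standard:
  assumes S: "open S" and f: "standard_forms S \<epsilon> \<eta> q r s f" and q: "q \<noteq> 0"
  shows "pointwise_describes 1 S A B f \<longleftrightarrow> smooth_forms S f \<and> (\<forall>u\<in>S.
    Dx (f 1 2) u = (\<epsilon> * q * u 2 + s) * f 2 2 u - f 3 2 u * (q * u 2 + r) \<and>
    Dx (f 2 2) u = q * (A u * u 3 + B u) + \<eta> * f 3 2 u - f 1 2 u * (\<epsilon> * q * u 2 + s) \<and>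
    Dx (f 3 2) u = \<epsilon> * q * (A u * u 3 + B u) + \<eta> * f 2 2 u - f 1 2 u * (q * u 2 + r))"
    (is "_ \<longleftrightarrow> _ \<and> (\<forall>u\<in>S. ?E u)")
proof -
  have "(\<forall>v. v 2 = A u * u 3 + B u \<longleftrightarrow> structure_equations 1 f u v) \<longleftrightarrow> ?E u" if u: "u \<in> S" for u
  proof
    assume "\<forall>v. v 2 = A u * u 3 + B u \<longleftrightarrow> structure_equations 1 f u v"
    from spec[OF this, of "\<lambda>_. A u * u 3 + B u"] show "?E u"
      by (simp add: structure_equations_standard[OF S u f])
  next
    assume E: "?E u"
    show "\<forall>v. v 2 = A u * u 3 + B u \<longleftrightarrow> structure_equations 1 f u v"
    proof (intro allI iffI)
      fix v :: jet assume "v 2 = A u * u 3 + B u"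
      then show "structure_equations 1 f u v"
        using E by (simp add: structure_equations_standard[OF S u f])
    next
      fix v :: jet assume "structure_equations 1 f u v"
      then have "q * v 2 = q * (A u * u 3 + B u)"
        using E unfolding structure_equations_standard[OF S u f] by linarith
      then show "v 2 = A u * u 3 + B u"
        using q by simp
    qed
  qed
  then show ?thesis
    unfolding pointwise_describes_def by (intro arg_cong2[where f = "(\<and>)"] ball_cong refl)
qed

text \<open>The equivalence is tested at one jet. Changing z_t must preserve the structure
  equations, so the terms in z vanish; changing z_2t must destroy them, so a leading coefficient is
  nonzero. With \<delta> = -1 the quadratic condition would be a vanishing sum of two squares, a
  contradiction.\<close>

lemma standard_forms_exist:
  assumes \<delta>: "\<delta> = 1 \<or> \<delta> = -1" and S: "open S" and u: "u \<in> S"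
    and d: "pointwise_describes \<delta> S A B f" and c: "conditions_f1 \<delta> S f"
  obtains \<epsilon> \<eta> q r s where "\<delta> = 1" "\<epsilon> \<in> {1, -1}" "q \<noteq> 0" "standard_forms S \<epsilon> \<eta> q r s f"
proof -
  obtain \<eta> where 1: "\<And>w. w \<in> S \<Longrightarrow> f 1 1 w = \<eta>"
    using c unfolding conditions_f1_def by blast
  obtain p q r where 2: "\<And>w. w \<in> S \<Longrightarrow> f 2 1 w = p * w 0 + q * w 2 + r"
    using c unfolding conditions_f1_def by blast
  obtain p' q' s where 3: "\<And>w. w \<in> S \<Longrightarrow> f 3 1 w = p' * w 0 + q' * w 2 + s"
    using c unfolding conditions_f1_def by blast
  have qq: "q'\<^sup>2 = \<delta> * q\<^sup>2"
  proof -
    have "\<forall>u\<in>S. (pd 2 (f 3 1) u)\<^sup>2 - \<delta> * (pd 2 (f 2 1) u)\<^sup>2 = 0"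
      using c unfolding conditions_f1_def by (elim conjE)
    from bspec[OF this u] show ?thesis
      using pd_affine_on[of S "f 2 1", OF S 2 u] pd_affine_on[of S "f 3 1", OF S 3 u] by simp
  qed
  have eqs: "v 2 = A u * u 3 + B u \<longleftrightarrow> structure_equations \<delta> f u v" for v
    using d u unfolding pointwise_describes_def by blast
  have Dt2: "Dt (f 2 1) u v = p * v 0 + q * v 2" and Dt3: "Dt (f 3 1) u v = p' * v 0 + q' * v 2" for v
    by (rule Dt_affine_on[of S "f 2 1", OF S 2 u] Dt_affine_on[of S "f 3 1", OF S 3 u]; assumption)+
  have Dt1: "Dt (f 1 1) u v = 0" for v
    using Dt_affine_on[OF S _ u, of "f 1 1" 0 0 \<eta> v] 1 by simp
  \<comment> \<open>\<open>x\<close> is the value of z_t, and \<open>y\<close> is the deviation of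
    z_2t from the value that the equation prescribes.\<close>
  let ?v = "\<lambda>x y i. if i = 0 then x else if i = (2 :: nat) then A u * u 3 + B u + y else 0"
  note se = structure_equations_def ext_d_def Dt1 Dt2 Dt3
  have base: "structure_equations \<delta> f u (?v 0 0)" "structure_equations \<delta> f u (?v 1 0)"
    "\<not> structure_equations \<delta> f u (?v 0 1)"
    unfolding eqs[symmetric] by simp_all
  have p: "p = 0" "p' = 0"
    using base(1,2) unfolding se by simp_all
  have q: "q \<noteq> 0 \<or> q' \<noteq> 0"
    using base(1,3) unfolding se by auto
  have "\<delta> = 1"
  proof (rule ccontr)
    assume "\<delta> \<noteq> 1"
    then have "q'\<^sup>2 + q\<^sup>2 = 0"
      using \<delta> qq by simp
    then show False
      using q by (simp add: sum_power2_eq_zero_iff)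
  qed
  moreover from this have "q' = q \<or> q' = - q"
    using qq by (simp add: power2_eq_iff)
  then obtain \<epsilon> where "\<epsilon> \<in> {1, -1}" "q' = \<epsilon> * q"
    by (elim disjE) (simp_all add: that[of 1] that[of "-1"])
  moreover from this have "q \<noteq> 0"
    using q by auto
  moreover have "standard_forms S \<epsilon> \<eta> q r s f"
    using 1 2 3 p \<open>q' = \<epsilon> * q\<close> by (simp add: standard_forms_def)
  ultimately show thesis
    using that by blast
qed

section \<open>Reduction of order\<close>

text \<open>
  Comparing the coefficients of the highest derivatives in the structure equations shows that
  \<open>f\<^sub>2\<^sub>2\<close>, \<open>f\<^sub>3\<^sub>2\<close> have order 2, \<open>f\<^sub>1\<^sub>2\<close> has order 1 and \<open>g = f\<^sub>3\<^sub>2 - \<epsilon> f\<^sub>2\<^sub>2\<close> depends on \<open>z\<close> only.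
\<close>

locale standard_description =
  fixes U :: "(real \<times> real \<times> real) set" and A B :: "jet \<Rightarrow> real"
    and f :: "nat \<Rightarrow> nat \<Rightarrow> jet \<Rightarrow> real" and \<epsilon> \<eta> q r s :: real
  assumes U: "open U" "convex U" "U \<noteq> {}"
    and A: "smooth_function 2 (jets_over U) A" and B: "smooth_function 2 (jets_over U) B"
    and pd_f: "pointwise_describes 1 (jets_over U) A B f"
    and std: "standard_forms (jets_over U) \<epsilon> \<eta> q r s f"
    and \<epsilon>: "\<epsilon> \<in> {1, -1}" and q: "q \<noteq> 0"
begin

abbreviation "S \<equiv> jets_over U"
abbreviation "\<kappa> \<equiv> s - \<epsilon> * r"

definition g :: "jet \<Rightarrow> real" where
  "g u = f 3 2 u - \<epsilon> * f 2 2 u"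

lemma open_S: "open S"
  using U(1) by (rule open_jets_over)

lemma eps_sq [simp]: "\<epsilon> * \<epsilon> = 1" "\<epsilon> * (\<epsilon> * x) = x"
  using \<epsilon> by auto

lemma smooth_f: "smooth_forms S f"
  using pd_f by (simp add: pointwise_describes_def)

lemma struct_eq:
  assumes "u \<in> S"
  shows "Dx (f 1 2) u = (\<epsilon> * q * u 2 + s) * f 2 2 u - f 3 2 u * (q * u 2 + r)"
    "Dx (f 2 2) u = q * (A u * u 3 + B u) + \<eta> * f 3 2 u - f 1 2 u * (\<epsilon> * q * u 2 + s)"
    "Dx (f 3 2) u = \<epsilon> * q * (A u * u 3 + B u) + \<eta> * f 2 2 u - f 1 2 u * (q * u 2 + r)"
  using pd_f assms unfolding pointwise_describes_standard[OF open_S std q] by blast+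

text \<open>Subtracting \<epsilon> times the second structure equation from the third cancels
  \<open>A u * u 3 + B u\<close>, which leaves a relation without z_3.\<close>

lemma Dx_g:
  assumes "u \<in> S"
  shows "Dx g u = \<epsilon> * \<kappa> * f 1 2 u - \<epsilon> * \<eta> * g u"
proof -
  have "Dx g u = Dx (f 3 2) u - \<epsilon> * Dx (f 2 2) u"
    unfolding g_def[abs_def] using smooth_formsD[OF smooth_f]
    by (simp add: Dx_rules[OF open_S assms] jet_smooth_intros open_S)
  then show ?thesis
    using \<epsilon> by (auto simp: struct_eq[OF assms] g_def algebra_simps)
qed

text \<open>Substituting \<open>f 3 2 = g + \<epsilon> * f 2 2\<close> cancels the products of z_2
  with \<open>f 2 2\<close>.\<close>

lemma Dx_f12:
  assumes "u \<in> S"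
  shows "Dx (f 1 2) u = \<kappa> * f 2 2 u - g u * (q * u 2 + r)"
  unfolding struct_eq(1)[OF assms] g_def by (simp add: algebra_simps)

lemma depends_AB: "depends_upto 2 S A" "depends_upto 2 S B"
  using A B by (simp_all add: smooth_function_def)

text \<open>A descent on the common order of the three coefficients, lowered together because each
  equation involves the others. If all have order k + 3, so do the right-hand sides, and
  \<open>Dx_order_drop_Suc\<close> gives k + 2. The descent stops at 2 because
  \<open>A u * u 3 + B u\<close> contains z_3.\<close>

lemma f_order_2: "smooth_function 2 S (f 1 2)" "smooth_function 2 S (f 2 2)" "smooth_function 2 S (f 3 2)"
proof -
  obtain k where k: "smooth_function k S (f 1 2)" "smooth_function k S (f 2 2)" "smooth_function k S (f 3 2)"
    using smooth_f unfolding smooth_forms_def by blast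
  have "smooth_function (k + 2) S (f 1 2) \<and> smooth_function (k + 2) S (f 2 2) \<and>
      smooth_function (k + 2) S (f 3 2) \<Longrightarrow>
    smooth_function 2 S (f 1 2) \<and> smooth_function 2 S (f 2 2) \<and> smooth_function 2 S (f 3 2)" for k
  proof (induction k)
    case (Suc k)
    have dep: "depends_upto (Suc (k + 2)) S (f 1 2)" "depends_upto (Suc (k + 2)) S (f 2 2)"
      "depends_upto (Suc (k + 2)) S (f 3 2)" "depends_upto (Suc (k + 2)) S A" "depends_upto (Suc (k + 2)) S B"
      using Suc.prems depends_upto_mono[OF depends_AB(1), of "Suc (k + 2)"]
        depends_upto_mono[OF depends_AB(2), of "Suc (k + 2)"] by (simp_all add: smooth_function_def)
    have sm: "smooth_function (Suc (k + 2)) S (f 1 2)" "smooth_function (Suc (k + 2)) S (f 2 2)"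
      "smooth_function (Suc (k + 2)) S (f 3 2)"
      using Suc.prems by simp_all
    have "smooth_function (k + 2) S (f 1 2)"
      by (rule Dx_order_drop_Suc[OF U(1,2) sm(1) _ struct_eq(1)], intro depends_upto_intros dep) simp_all
    moreover have "smooth_function (k + 2) S (f 2 2)"
      by (rule Dx_order_drop_Suc[OF U(1,2) sm(2) _ struct_eq(2)], intro depends_upto_intros dep) simp_all
    moreover have "smooth_function (k + 2) S (f 3 2)"
      by (rule Dx_order_drop_Suc[OF U(1,2) sm(3) _ struct_eq(3)], intro depends_upto_intros dep) simp_all
    ultimately show ?case
      by (intro Suc.IH conjI)
  qed simp
  moreover have "smooth_function (k + 2) S (f 1 2) \<and> smooth_function (k + 2) S (f 2 2) \<and>
      smooth_function (k + 2) S (f 3 2)"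
    using k[THEN smooth_function_mono] by simp
  ultimately have "smooth_function 2 S (f 1 2) \<and> smooth_function 2 S (f 2 2) \<and> smooth_function 2 S (f 3 2)" .
  then show "smooth_function 2 S (f 1 2)" "smooth_function 2 S (f 2 2)" "smooth_function 2 S (f 3 2)"
    by simp_all
qed

text \<open>The first structure equation contains no z_3, which permits one more drop.\<close>

lemma f12_order_1: "smooth_function 1 S (f 1 2)"
proof (rule Dx_order_drop_Suc[OF U(1,2) _ _ struct_eq(1)])
  show "depends_upto (Suc 1) S
      (\<lambda>u. (\<epsilon> * q * u 2 + s) * f 2 2 u - f 3 2 u * (q * u 2 + r))"
    by (intro depends_upto_intros) (use f_order_2 in \<open>simp_all add: smooth_function_def\<close>)
qed (use f_order_2 in simp_all)

text \<open>By \<open>Dx_g\<close> and \<open>f12_order_1\<close>, \<open>Dx g\<close> has order at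
  most the larger of 1 and the order of \<open>g\<close>; two drops lead from 2 to 0.\<close>

lemma g_order_0: "smooth_function 0 S g"
proof -
  have dep: "depends_upto 1 S (f 1 2)"
    using f12_order_1 by (simp add: smooth_function_def)
  have "smooth_function 2 S g"
    unfolding g_def[abs_def] using f_order_2 by (intro smooth_function_intros open_S)
  then have sm: "smooth_function (Suc 1) S g"
    by simp
  have "smooth_function 1 S g"
    by (rule Dx_order_drop_Suc[OF U(1,2) sm _ Dx_g], intro depends_upto_intros depends_upto_mono[OF dep])
      (use sm in \<open>simp_all add: smooth_function_def\<close>)
  then have sm: "smooth_function (Suc 0) S g"
    by simp
  show ?thesis
    by (rule Dx_order_drop_Suc[OF U(1,2) sm _ Dx_g], intro depends_upto_intros depends_upto_mono[OF dep])
      (use sm in \<open>simp_all add: smooth_function_def\<close>)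
qed

text \<open>For \<kappa> = 0 the relations for \<open>g\<close> and \<open>f 1 2\<close> decouple:
  first \<open>g\<close> turns out constant, then \<open>f 1 2\<close> is integrated, and the two
  product conditions are what remains of the relations.\<close>

lemma degenerate_case:
  assumes "\<kappa> = 0"
  obtains g0 w0 where "\<forall>u\<in>S. f 3 2 u = \<epsilon> * f 2 2 u + g0"
    "\<forall>u\<in>S. f 1 2 u = - g0 * q * u 1 + w0" "\<eta> * g0 = 0" "g0 * r = 0"
proof -
  obtain u0 where u0: "u0 \<in> S"
  proof -
    obtain x y z where "(x, y, z) \<in> U"
      using U(3) by auto
    then show thesis
      by (intro that[of "\<lambda>i. if i = 0 then x else if i = 1 then y else z"]) (simp add: jets_over_def)
  qed
  have dep: "depends_upto 0 S g"
    using g_order_0 by (simp add: smooth_function_def)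
  have Dg: "Dx g u = - \<epsilon> * \<eta> * g u" if "u \<in> S" for u
    using Dx_g[OF that] assms by simp
  \<comment> \<open>For order 0 \<open>Dx_order_drop\<close> requires no common coordinates, so it
    yields constancy on all of \<open>S\<close>.\<close>
  have g_const: "g u = g u0" if "u \<in> S" for u
    by (rule Dx_order_drop[OF U(1,2) g_order_0 _ Dg that u0], intro depends_upto_intros dep) simp_all
  have "Dx g u0 = 0"
    using Dx_cong[OF open_S g_const u0] by simp
  then have eta: "\<eta> * g u0 = 0"
    using Dg[OF u0] \<epsilon> by auto
  \<comment> \<open>The added term absorbs the z_2 part of \<open>Dx (f 1 2)\<close>, so that
    \<open>Dx F\<close> is constant; then \<open>F\<close> is constant too, and \<open>Dx F\<close>
    is zero.\<close>
  define F where "F u = f 1 2 u + g u0 * q * u 1" for u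
  have smF: "smooth_function 1 S F"
    unfolding F_def[abs_def] using f12_order_1 by (intro smooth_function_intros open_S) auto
  have DF: "Dx F u = - g u0 * r" if "u \<in> S" for u
  proof -
    have "Dx F u = Dx (f 1 2) u + g u0 * q * u 2"
      unfolding F_def[abs_def] using smooth_formsD[OF smooth_f]
      by (simp add: Dx_rules[OF open_S that] jet_smooth_intros open_S)
    then show ?thesis
      using Dx_f12[OF that] assms g_const[OF that] by (simp add: algebra_simps)
  qed
  have "smooth_function 0 S F"
    by (rule Dx_order_drop_Suc[OF U(1,2) _ depends_upto_const DF]) (use smF in simp_all)
  then have F_const: "F u = F u0" if "u \<in> S" for u
    by (rule Dx_order_drop[OF U(1,2) _ depends_upto_const DF that u0]) simp_all
  have "Dx F u0 = 0"
    using Dx_cong[OF open_S F_const u0] by simp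
  then have "g u0 * r = 0"
    using DF[OF u0] by simp
  moreover have "\<forall>u\<in>S. f 3 2 u = \<epsilon> * f 2 2 u + g u0"
  proof
    show "f 3 2 u = \<epsilon> * f 2 2 u + g u0" if "u \<in> S" for u
      using g_const[OF that] by (simp add: g_def[of u])
  qed
  moreover have "\<forall>u\<in>S. f 1 2 u = - g u0 * q * u 1 + F u0"
  proof
    show "f 1 2 u = - g u0 * q * u 1 + F u0" if "u \<in> S" for u
      using F_const[OF that] by (simp add: F_def[of u])
  qed
  ultimately show thesis
    using that[of "g u0" "F u0"] eta by blast
qed

end

section \<open>The first form\<close>

text \<open>The part of form (I) that concerns the coefficients, separated from the equation so that
  \<open>coeffs_I_describes_iff\<close> can be used in both directions.\<close>

definition coeffs_I ::
  "jet set \<Rightarrow> real \<Rightarrow> real \<Rightarrow> real \<Rightarrow> real \<Rightarrow> real \<Rightarrow> real \<Rightarrow> (jet \<Rightarrow> real) \<Rightarrow>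
    (nat \<Rightarrow> nat \<Rightarrow> jet \<Rightarrow> real) \<Rightarrow> bool" where
  "coeffs_I S \<epsilon> a b \<alpha> m n \<psi> f \<longleftrightarrow> (\<forall>u\<in>S.
     f 1 1 u = - \<epsilon> * a \<and>
     f 1 2 u = (1 - a) * (m * u 1 + n) + \<epsilon> * b \<and>
     f 2 1 u = u 2 + \<alpha> \<and>
     f 2 2 u = \<psi> u - \<epsilon> * (1 - a) * (m / 2 * (u 1)\<^sup>2 + n * u 1) - \<alpha> * b \<and>
     f 3 1 u = \<epsilon> * f 2 1 u \<and>
     f 3 2 u = \<epsilon> * f 2 2 u - (1 - a) * m)"

lemma form_I_iff:
  "form_I S A B f \<longleftrightarrow>
     (\<exists>\<epsilon>\<in>{1, -1}. \<exists>a\<in>{0, 1}. \<exists>b\<in>{0, 1}. \<exists>\<alpha> m n. \<exists>\<psi>.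
        smooth_function 2 S \<psi> \<and> (a - 1) * \<alpha> * m = 0 \<and> (a - 1) * b = 0 \<and>
        generically_nonzero S (\<lambda>u. a * \<psi> u + b * u 2 + m\<^sup>2 + n\<^sup>2) \<and>
        coeffs_I S \<epsilon> a b \<alpha> m n \<psi> f \<and>
        (\<forall>u\<in>S. A u * u 3 + B u = Dx \<psi> u + a * \<psi> u + b * u 2 + \<epsilon> * n * (1 - a) * \<alpha>))"
  unfolding form_I_def coeffs_I_def ball_conj_distrib by (simp only: conj_ac)

lemma coeffs_ID:
  assumes "coeffs_I S \<epsilon> a b \<alpha> m n \<psi> f" "u \<in> S"
  shows "f 1 1 u = - \<epsilon> * a"
    "f 1 2 u = (1 - a) * (m * u 1 + n) + \<epsilon> * b"
    "f 2 1 u = u 2 + \<alpha>"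
    "f 2 2 u = \<psi> u - \<epsilon> * (1 - a) * (m / 2 * (u 1)\<^sup>2 + n * u 1) - \<alpha> * b"
    "f 3 1 u = \<epsilon> * f 2 1 u"
    "f 3 2 u = \<epsilon> * f 2 2 u - (1 - a) * m"
  using assms unfolding coeffs_I_def by blast+

lemma coeffs_I_standard:
  assumes "coeffs_I S \<epsilon> a b \<alpha> m n \<psi> f"
  shows "standard_forms S \<epsilon> (- \<epsilon> * a) 1 \<alpha> (\<epsilon> * \<alpha>) f"
  unfolding standard_forms_def
  by (intro ballI) (simp add: coeffs_ID(1,3,5)[OF assms] distrib_left)

lemma coeffs_I_smooth:
  assumes S: "open S" and \<psi>: "smooth_function 2 S \<psi>" and f: "coeffs_I S \<epsilon> a b \<alpha> m n \<psi> f"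
  shows "smooth_forms S f"
proof -
  note eqs = coeffs_ID[OF f]
  have *: "jet_smooth S F" if "\<And>u. u \<in> S \<Longrightarrow> F u = G u" "jet_smooth S G" for F G
    by (rule jet_smooth_cong[OF S _ that(2)]) (simp add: that(1))
  note intros = jet_smooth_intros S jet_smoothI[OF \<psi>]
  have "jet_smooth S (f 1 1)"
    by (rule *[OF eqs(1)], assumption, intro intros)
  moreover have "jet_smooth S (f 1 2)"
    by (rule *[OF eqs(2)], assumption, intro intros)
  moreover have 21: "jet_smooth S (f 2 1)"
    by (rule *[OF eqs(3)], assumption, intro intros)
  moreover have 22: "jet_smooth S (f 2 2)"
    by (rule *[OF eqs(4)], assumption, intro intros)
  moreover have "jet_smooth S (f 3 1)"
    by (rule *[OF eqs(5)], assumption, intro intros 21)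
  moreover have "jet_smooth S (f 3 2)"
    by (rule *[OF eqs(6)], assumption, intro intros 22)
  ultimately show ?thesis
    by (simp add: smooth_forms_iff)
qed

text \<open>Under the constraints on the parameters the first structure equation holds identically
  and the third is \<epsilon> times the second. The second one is the equation of form (I).\<close>

lemma coeffs_I_describes_iff:
  assumes S: "open S" and \<psi>: "smooth_function 2 S \<psi>" and f: "coeffs_I S \<epsilon> a b \<alpha> m n \<psi> f"
    and \<epsilon>: "\<epsilon> \<in> {1, -1}" and a: "a \<in> {0, 1}" and ab: "(a - 1) * \<alpha> * m = 0" "(a - 1) * b = 0"
  shows "pointwise_describes 1 S A B f \<longleftrightarrow>
    (\<forall>u\<in>S. A u * u 3 + B u = Dx \<psi> u + a * \<psi> u + b * u 2 + \<epsilon> * n * (1 - a) * \<alpha>)"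
proof -
  have D12: "Dx (f 1 2) u = (1 - a) * m * u 2" if "u \<in> S" for u
  proof -
    have "Dx (f 1 2) u = Dx (\<lambda>u. (1 - a) * (m * u 1 + n) + \<epsilon> * b) u"
      by (rule Dx_cong[OF S _ that]) (rule coeffs_ID(2)[OF f])
    also have "\<dots> = (1 - a) * m * u 2"
      by (simp add: Dx_rules[OF S that] jet_smooth_intros S)
    finally show ?thesis .
  qed
  have D22: "Dx (f 2 2) u = Dx \<psi> u - \<epsilon> * (1 - a) * (m * u 1 * u 2 + n * u 2)" if "u \<in> S" for u
  proof -
    have "Dx (f 2 2) u = Dx (\<lambda>u. \<psi> u - \<epsilon> * (1 - a) * (m / 2 * (u 1)\<^sup>2 + n * u 1) - \<alpha> * b) u"
      by (rule Dx_cong[OF S _ that]) (rule coeffs_ID(4)[OF f])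
    also have "\<dots> = Dx \<psi> u - \<epsilon> * (1 - a) * (m * u 1 * u 2 + n * u 2)"
      by (simp add: Dx_rules[OF S that] jet_smooth_intros jet_smoothI[OF \<psi>] S)
    finally show ?thesis .
  qed
  have sm: "smooth_forms S f"
    using S \<psi> f by (rule coeffs_I_smooth)
  have D32: "Dx (f 3 2) u = \<epsilon> * Dx (f 2 2) u" if "u \<in> S" for u
  proof -
    have "Dx (f 3 2) u = Dx (\<lambda>u. \<epsilon> * f 2 2 u - (1 - a) * m) u"
      by (rule Dx_cong[OF S _ that]) (rule coeffs_ID(6)[OF f])
    also have "\<dots> = \<epsilon> * Dx (f 2 2) u"
      by (simp add: Dx_rules[OF S that] jet_smooth_intros smooth_formsD[OF sm] S)
    finally show ?thesis .
  qed
  have am: "a = 1 \<or> a = 0 \<and> b = 0 \<and> (\<alpha> = 0 \<or> m = 0)"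
    using a ab by auto
  have "(Dx (f 1 2) u = (\<epsilon> * 1 * u 2 + \<epsilon> * \<alpha>) * f 2 2 u - f 3 2 u * (1 * u 2 + \<alpha>) \<and>
      Dx (f 2 2) u = 1 * G + - \<epsilon> * a * f 3 2 u - f 1 2 u * (\<epsilon> * 1 * u 2 + \<epsilon> * \<alpha>) \<and>
      Dx (f 3 2) u = \<epsilon> * 1 * G + - \<epsilon> * a * f 2 2 u - f 1 2 u * (1 * u 2 + \<alpha>)) \<longleftrightarrow>
    G = Dx \<psi> u + a * \<psi> u + b * u 2 + \<epsilon> * n * (1 - a) * \<alpha>" if u: "u \<in> S" for u G
  proof -
    show ?thesis
      unfolding D32[OF u] D22[OF u] D12[OF u] coeffs_ID(2,4,6)[OF f u] using \<epsilon> am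
      by (elim disjE insertE emptyE conjE) (simp_all add: algebra_simps, auto)
  qed
  then show ?thesis
    unfolding pointwise_describes_standard[OF S coeffs_I_standard[OF f] one_neq_zero]
    using sm by (simp only: simp_thms cong: ball_cong)
qed

lemma coeffs_I_wedge:
  assumes f: "coeffs_I S \<epsilon> a b \<alpha> m n \<psi> f" and u: "u \<in> S" and a: "a \<in> {0, 1}" "(a - 1) * b = 0"
  shows "wedge f 1 2 u = (if a = 1 then - \<epsilon> * (\<psi> u + b * u 2) else - (m * u 1 + n) * (u 2 + \<alpha>))"
  unfolding wedge_def coeffs_ID(1-4)[OF f u] using a by (auto simp: algebra_simps)

lemma form_I_imp_describes:
  assumes S: "open S" and f: "form_I S A B f"
  shows "pointwise_describes 1 S A B f \<and> conditions_f1 1 S f"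
proof -
  obtain \<epsilon> a b \<alpha> m n \<psi> where
    *: "\<epsilon> \<in> {1, -1}" "a \<in> {0, 1}" "smooth_function 2 S \<psi>" "(a - 1) * \<alpha> * m = 0" "(a - 1) * b = 0"
      "coeffs_I S \<epsilon> a b \<alpha> m n \<psi> f"
    and G: "\<forall>u\<in>S. A u * u 3 + B u = Dx \<psi> u + a * \<psi> u + b * u 2 + \<epsilon> * n * (1 - a) * \<alpha>"
    using f unfolding form_I_iff by blast
  have "pointwise_describes 1 S A B f"
    using coeffs_I_describes_iff[OF S *(3,6,1,2,4,5)] G by blast
  then show ?thesis
    using conditions_f1_standard[OF S coeffs_I_standard[OF *(6)] *(1)] by blast
qed

text \<open>The nonvanishing condition of form (I) is read off from the wedge product. For
  \<open>a = 1\<close>, where \<open>m = n = 0\<close>, the two agree up to the factor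
  \<open>- \<epsilon>\<close>; for \<open>a = 0\<close> the factor \<open>m * u 1 + n\<close> of the
  wedge product excludes \<open>m = n = 0\<close>.\<close>

lemma form_I_intro:
  assumes S: "open S" and f: "coeffs_I S \<epsilon> a b \<alpha> m n \<psi> f" and \<psi>: "smooth_function 2 S \<psi>"
    and \<epsilon>: "\<epsilon> \<in> {1, -1}" and a: "a \<in> {0, 1}" and b: "b \<in> {0, 1}"
    and ab: "(a - 1) * \<alpha> * m = 0" "(a - 1) * b = 0" and d: "pointwise_describes 1 S A B f"
    and wedge: "\<exists>u\<in>S. wedge f 1 2 u \<noteq> 0" and mn: "a = 1 \<Longrightarrow> m = 0 \<and> n = 0"
  shows "form_I S A B f"
proof -
  obtain u where u: "u \<in> S" "wedge f 1 2 u \<noteq> 0"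
    using wedge by blast
  have "a * \<psi> u + b * u 2 + m\<^sup>2 + n\<^sup>2 \<noteq> 0"
  proof (cases "a = 1")
    case True
    then show ?thesis
      using u(2) mn unfolding coeffs_I_wedge[OF f u(1) a ab(2)] by simp
  next
    case False
    then have "a = 0" "b = 0" "m \<noteq> 0 \<or> n \<noteq> 0"
      using a ab(2) u(2) unfolding coeffs_I_wedge[OF f u(1) a ab(2)] by auto
    then show ?thesis
      by (simp add: sum_power2_eq_zero_iff)
  qed
  moreover have "continuous_on S (\<lambda>u. a * \<psi> u + b * u 2 + m\<^sup>2 + n\<^sup>2)"
    by (intro jet_smooth_imp_continuous_on jet_smooth_intros S jet_smoothI[OF \<psi>])
  ultimately have "generically_nonzero S (\<lambda>u. a * \<psi> u + b * u 2 + m\<^sup>2 + n\<^sup>2)"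
    using u(1) generically_nonzero_iff[OF S] by blast
  then show ?thesis
    unfolding form_I_iff using coeffs_I_describes_iff[OF S \<psi> f \<epsilon> a ab] d
    by (intro bexI[OF _ \<epsilon>] bexI[OF _ a] bexI[OF _ b] exI[of _ \<alpha>] exI[of _ m] exI[of _ n] exI[of _ \<psi>]
        conjI \<psi> ab f) simp_all
qed

section \<open>The second form\<close>

definition coeffs_II ::
  "jet set \<Rightarrow> real \<Rightarrow> real \<Rightarrow> real \<Rightarrow> real \<Rightarrow> (jet \<Rightarrow> real) \<Rightarrow> (nat \<Rightarrow> nat \<Rightarrow> jet \<Rightarrow> real) \<Rightarrow> bool" where
  "coeffs_II S \<epsilon> \<alpha> \<beta> \<eta> H f \<longleftrightarrow> (\<forall>u\<in>S.
     f 1 1 u = \<eta> \<and>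
     f 1 2 u = - \<epsilon> * Dx H u - \<eta> * H u \<and>
     f 2 1 u = u 2 / (\<alpha> - \<epsilon> * \<beta>) + \<beta> \<and>
     f 2 2 u = (- \<epsilon> * Dx (Dx H) u - \<eta> * Dx H u) / (\<alpha> - \<epsilon> * \<beta>)
               - (u 2 / (\<alpha> - \<epsilon> * \<beta>) + \<beta>) * H u \<and>
     f 3 1 u = \<epsilon> * u 2 / (\<alpha> - \<epsilon> * \<beta>) + \<alpha> \<and>
     f 3 2 u = (- Dx (Dx H) u - \<epsilon> * \<eta> * Dx H u) / (\<alpha> - \<epsilon> * \<beta>)
               - \<epsilon> * (u 2 / (\<alpha> - \<epsilon> * \<beta>) + \<epsilon> * \<alpha>) * H u)"

lemma ball_conj_swap: "(\<forall>u\<in>S. P u \<and> Q u) \<longleftrightarrow> (\<forall>u\<in>S. Q u) \<and> (\<forall>u\<in>S. P u)"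
  by blast

lemma form_II_iff:
  "form_II S A B f \<longleftrightarrow> (\<exists>\<epsilon>\<in>{1, -1}. \<exists>\<alpha> \<beta> \<eta>. \<exists>h :: real \<Rightarrow> real.
     \<alpha> - \<epsilon> * \<beta> \<noteq> 0 \<and> smooth_function 0 S (\<lambda>u. h (u 0)) \<and>
     generically_nonzero S (\<lambda>u. deriv h (u 0)) \<and> coeffs_II S \<epsilon> \<alpha> \<beta> \<eta> (\<lambda>u. h (u 0)) f \<and>
     (\<forall>u\<in>S. A u * u 3 + B u = - \<epsilon> * Dx (Dx (Dx (\<lambda>u. h (u 0)))) u
        - Dx (\<lambda>w. (w 2 + \<epsilon> * (\<alpha>\<^sup>2 - \<beta>\<^sup>2 - \<eta>\<^sup>2)) * h (w 0)) u - u 2 * Dx (\<lambda>u. h (u 0)) u))"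
proof -
  have funpow: "(Dx ^^ 3) H = Dx (Dx (Dx H))" "(Dx ^^ 2) H = Dx (Dx H)" for H
    by (simp_all only: numeral_3_eq_3 numeral_2_eq_2 funpow.simps o_apply id_apply)
  show ?thesis
    unfolding form_II_def coeffs_II_def Let_def funpow
    by (intro bex_cong[OF refl] ex_cong1 arg_cong2[where f = "(\<and>)"] refl ball_conj_swap)
qed

lemma coeffs_IID:
  assumes "coeffs_II S \<epsilon> \<alpha> \<beta> \<eta> H f" "u \<in> S"
  shows "f 1 1 u = \<eta>"
    "f 1 2 u = - \<epsilon> * Dx H u - \<eta> * H u"
    "f 2 1 u = u 2 / (\<alpha> - \<epsilon> * \<beta>) + \<beta>"
    "f 2 2 u = (- \<epsilon> * Dx (Dx H) u - \<eta> * Dx H u) / (\<alpha> - \<epsilon> * \<beta>)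
      - (u 2 / (\<alpha> - \<epsilon> * \<beta>) + \<beta>) * H u"
    "f 3 1 u = \<epsilon> * u 2 / (\<alpha> - \<epsilon> * \<beta>) + \<alpha>"
    "f 3 2 u = (- Dx (Dx H) u - \<epsilon> * \<eta> * Dx H u) / (\<alpha> - \<epsilon> * \<beta>)
      - \<epsilon> * (u 2 / (\<alpha> - \<epsilon> * \<beta>) + \<epsilon> * \<alpha>) * H u"
  using assms unfolding coeffs_II_def by blast+

lemma coeffs_II_standard:
  assumes "coeffs_II S \<epsilon> \<alpha> \<beta> \<eta> H f"
  shows "standard_forms S \<epsilon> \<eta> (1 / (\<alpha> - \<epsilon> * \<beta>)) \<beta> \<alpha> f"
  using assms by (simp add: coeffs_II_def standard_forms_def)

lemma coeffs_II_smooth: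
  assumes S: "open S" and H: "jet_smooth S H" and f: "coeffs_II S \<epsilon> \<alpha> \<beta> \<eta> H f"
  shows "smooth_forms S f"
proof -
  note eqs = coeffs_IID[OF f]
  have *: "jet_smooth S F" if "\<And>u. u \<in> S \<Longrightarrow> F u = G u" "jet_smooth S G" for F G
    by (rule jet_smooth_cong[OF S _ that(2)]) (simp add: that(1))
  have "jet_smooth S (f 1 1)"
    by (rule *[OF eqs(1)], assumption, intro jet_smooth_intros S H)
  moreover have "jet_smooth S (f 1 2)"
    by (rule *[OF eqs(2)], assumption, intro jet_smooth_intros S H)
  moreover have "jet_smooth S (f 2 1)"
    by (rule *[OF eqs(3)], assumption, intro jet_smooth_intros S H)
  moreover have "jet_smooth S (f 2 2)"
    by (rule *[OF eqs(4)], assumption, intro jet_smooth_intros S H)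
  moreover have "jet_smooth S (f 3 1)"
    by (rule *[OF eqs(5)], assumption, intro jet_smooth_intros S H)
  moreover have "jet_smooth S (f 3 2)"
    by (rule *[OF eqs(6)], assumption, intro jet_smooth_intros S H)
  ultimately show ?thesis
    by (simp add: smooth_forms_iff)
qed

text \<open>\<open>H0\<close> to \<open>H3\<close> stand for \<open>H\<close> and its iterated total
  derivatives, \<open>x\<close> and \<open>y\<close> for z_2 and z_3, and \<open>k\<close> for the
  reciprocal of \<open>\<alpha> - \<epsilon> * \<beta>\<close>. The claims are the three structure
  equations: the first is an identity, the second is equivalent to the equation, the third follows
  from it.\<close>

lemma form_II_algebra:
  fixes k \<alpha> \<beta> \<epsilon> \<eta> x y H0 H1 H2 H3 G :: real
  defines "F12 \<equiv> - \<epsilon> * H1 - \<eta> * H0"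
    and "F22 \<equiv> (- \<epsilon> * H2 - \<eta> * H1) * k - (x * k + \<beta>) * H0"
    and "F32 \<equiv> (- H2 - \<epsilon> * \<eta> * H1) * k - \<epsilon> * (x * k + \<epsilon> * \<alpha>) * H0"
    and "G0 \<equiv> - \<epsilon> * H3 - (y * H0 + (x + \<epsilon> * (\<alpha>\<^sup>2 - \<beta>\<^sup>2 - \<eta>\<^sup>2)) * H1) - x * H1"
  assumes \<epsilon>: "\<epsilon> \<in> {1, -1}" and k: "k * (\<alpha> - \<epsilon> * \<beta>) = 1"
  shows "- \<epsilon> * H2 - \<eta> * H1 = (\<epsilon> * k * x + \<alpha>) * F22 - F32 * (k * x + \<beta>)"
    and "(- \<epsilon> * H3 - \<eta> * H2) * k - (y * k * H0 + (x * k + \<beta>) * H1) =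
      k * G + \<eta> * F32 - F12 * (\<epsilon> * k * x + \<alpha>) \<longleftrightarrow> G = G0"
    and "G = G0 \<Longrightarrow> (- H3 - \<epsilon> * \<eta> * H2) * k - \<epsilon> * (y * k * H0 + (x * k + \<epsilon> * \<alpha>) * H1) =
      \<epsilon> * k * G + \<eta> * F22 - F12 * (k * x + \<beta>)"
proof -
  have \<epsilon>2: "\<epsilon> * \<epsilon> = 1"
    using \<epsilon> by auto
  show "- \<epsilon> * H2 - \<eta> * H1 = (\<epsilon> * k * x + \<alpha>) * F22 - F32 * (k * x + \<beta>)"
    unfolding F22_def F32_def using \<epsilon>2 k by algebra
  have "(- \<epsilon> * H3 - \<eta> * H2) * k - (y * k * H0 + (x * k + \<beta>) * H1) =
      k * G0 + \<eta> * F32 - F12 * (\<epsilon> * k * x + \<alpha>)"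
    unfolding F32_def F12_def G0_def power2_eq_square using \<epsilon>2 k by algebra
  moreover have "k \<noteq> 0"
    using k by auto
  ultimately show "(- \<epsilon> * H3 - \<eta> * H2) * k - (y * k * H0 + (x * k + \<beta>) * H1) =
      k * G + \<eta> * F32 - F12 * (\<epsilon> * k * x + \<alpha>) \<longleftrightarrow> G = G0"
    by auto
  have "(- H3 - \<epsilon> * \<eta> * H2) * k - \<epsilon> * (y * k * H0 + (x * k + \<epsilon> * \<alpha>) * H1) =
      \<epsilon> * k * G0 + \<eta> * F22 - F12 * (k * x + \<beta>)"
    unfolding F22_def F12_def G0_def power2_eq_square using \<epsilon>2 k by algebra
  then show "G = G0 \<Longrightarrow> (- H3 - \<epsilon> * \<eta> * H2) * k - \<epsilon> * (y * k * H0 + (x * k + \<epsilon> * \<alpha>) * H1) =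
      \<epsilon> * k * G + \<eta> * F22 - F12 * (k * x + \<beta>)"
    by simp
qed

lemma coeffs_II_describes_iff:
  assumes S: "open S" and H: "jet_smooth S H" and f: "coeffs_II S \<epsilon> \<alpha> \<beta> \<eta> H f"
    and \<epsilon>: "\<epsilon> \<in> {1, -1}" and \<kappa>: "\<alpha> - \<epsilon> * \<beta> \<noteq> 0"
  shows "pointwise_describes 1 S A B f \<longleftrightarrow>
    (\<forall>u\<in>S. A u * u 3 + B u = - \<epsilon> * Dx (Dx (Dx H)) u
        - Dx (\<lambda>w. (w 2 + \<epsilon> * (\<alpha>\<^sup>2 - \<beta>\<^sup>2 - \<eta>\<^sup>2)) * H w) u - u 2 * Dx H u)"
proof -
  note f_eq = f[unfolded coeffs_II_def, rule_format]
  define k where "k = 1 / (\<alpha> - \<epsilon> * \<beta>)"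
  have k: "k * (\<alpha> - \<epsilon> * \<beta>) = 1" "k \<noteq> 0" and div: "x / (\<alpha> - \<epsilon> * \<beta>) = x * k" for x
    using \<kappa> by (simp_all add: k_def)
  have sm: "smooth_forms S f"
    using S H f by (rule coeffs_II_smooth)
  note js = jet_smooth_intros S H
  have D: "Dx (f 1 2) u = - \<epsilon> * Dx (Dx H) u - \<eta> * Dx H u"
      "Dx (f 2 2) u = (- \<epsilon> * Dx (Dx (Dx H)) u - \<eta> * Dx (Dx H) u) * k
        - (u 3 * k * H u + (u 2 * k + \<beta>) * Dx H u)"
      "Dx (f 3 2) u = (- Dx (Dx (Dx H)) u - \<epsilon> * \<eta> * Dx (Dx H) u) * k
        - \<epsilon> * (u 3 * k * H u + (u 2 * k + \<epsilon> * \<alpha>) * Dx H u)"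
      "Dx (\<lambda>w. (w 2 + \<epsilon> * (\<alpha>\<^sup>2 - \<beta>\<^sup>2 - \<eta>\<^sup>2)) * H w) u =
        u 3 * H u + (u 2 + \<epsilon> * (\<alpha>\<^sup>2 - \<beta>\<^sup>2 - \<eta>\<^sup>2)) * Dx H u" if u: "u \<in> S" for u
  proof -
    have "Dx (f 1 2) u = Dx (\<lambda>u. - \<epsilon> * Dx H u - \<eta> * H u) u"
      by (rule Dx_cong[OF S _ u]) (use f_eq in blast)
    then show "Dx (f 1 2) u = - \<epsilon> * Dx (Dx H) u - \<eta> * Dx H u"
      by (simp add: Dx_rules[OF S u] js)
    have "Dx (f 2 2) u = Dx (\<lambda>u. (- \<epsilon> * Dx (Dx H) u - \<eta> * Dx H u) * k - (u 2 * k + \<beta>) * H u) u"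
      by (rule Dx_cong[OF S _ u]) (use f_eq div in simp)
    then show "Dx (f 2 2) u = (- \<epsilon> * Dx (Dx (Dx H)) u - \<eta> * Dx (Dx H) u) * k
        - (u 3 * k * H u + (u 2 * k + \<beta>) * Dx H u)"
      by (simp add: Dx_rules[OF S u] js)
    have "Dx (f 3 2) u =
        Dx (\<lambda>u. (- Dx (Dx H) u - \<epsilon> * \<eta> * Dx H u) * k - \<epsilon> * (u 2 * k + \<epsilon> * \<alpha>) * H u) u"
      by (rule Dx_cong[OF S _ u]) (use f_eq div in simp)
    then show "Dx (f 3 2) u = (- Dx (Dx (Dx H)) u - \<epsilon> * \<eta> * Dx (Dx H) u) * k
        - \<epsilon> * (u 3 * k * H u + (u 2 * k + \<epsilon> * \<alpha>) * Dx H u)"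
      by (simp add: Dx_rules[OF S u] js algebra_simps)
    show "Dx (\<lambda>w. (w 2 + \<epsilon> * (\<alpha>\<^sup>2 - \<beta>\<^sup>2 - \<eta>\<^sup>2)) * H w) u =
        u 3 * H u + (u 2 + \<epsilon> * (\<alpha>\<^sup>2 - \<beta>\<^sup>2 - \<eta>\<^sup>2)) * Dx H u"
      by (simp add: Dx_rules[OF S u] js)
  qed
  have "(Dx (f 1 2) u = (\<epsilon> * k * u 2 + \<alpha>) * f 2 2 u - f 3 2 u * (k * u 2 + \<beta>) \<and>
      Dx (f 2 2) u = k * G + \<eta> * f 3 2 u - f 1 2 u * (\<epsilon> * k * u 2 + \<alpha>) \<and>
      Dx (f 3 2) u = \<epsilon> * k * G + \<eta> * f 2 2 u - f 1 2 u * (k * u 2 + \<beta>)) \<longleftrightarrow>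
    G = - \<epsilon> * Dx (Dx (Dx H)) u - Dx (\<lambda>w. (w 2 + \<epsilon> * (\<alpha>\<^sup>2 - \<beta>\<^sup>2 - \<eta>\<^sup>2)) * H w) u - u 2 * Dx H u"
    if u: "u \<in> S" for u G
  proof -
    have eqs: "f 1 2 u = - \<epsilon> * Dx H u - \<eta> * H u"
      "f 2 2 u = (- \<epsilon> * Dx (Dx H) u - \<eta> * Dx H u) * k - (u 2 * k + \<beta>) * H u"
      "f 3 2 u = (- Dx (Dx H) u - \<epsilon> * \<eta> * Dx H u) * k - \<epsilon> * (u 2 * k + \<epsilon> * \<alpha>) * H u"
      using f_eq[OF u] unfolding div by blast+
    show ?thesis
      unfolding D[OF u] eqs
      using form_II_algebra(1)[OF \<epsilon> k(1), where x = "u 2" and \<eta> = \<eta> and ?H0.0 = "H u"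
          and ?H1.0 = "Dx H u" and ?H2.0 = "Dx (Dx H) u"]
        form_II_algebra(2,3)[OF \<epsilon> k(1), where x = "u 2" and y = "u 3" and \<eta> = \<eta> and ?H0.0 = "H u"
          and ?H1.0 = "Dx H u" and ?H2.0 = "Dx (Dx H) u" and ?H3.0 = "Dx (Dx (Dx H)) u" and G = G]
      by blast
  qed
  then show ?thesis
    unfolding pointwise_describes_standard[OF S coeffs_II_standard[OF f, folded k_def] k(2)]
    using sm by (simp only: simp_thms cong: ball_cong)
qed

section \<open>Total derivatives of functions of z alone\<close>

lemma Dx_order_0:
  assumes S: "open S" and H: "smooth_function 0 S (\<lambda>u. h (u 0))" and u: "u \<in> S"
  shows "Dx (\<lambda>u. h (u 0)) u = u 1 * deriv h (u 0)"
  using Dx_eq_sum[OF S _ u order_refl, of 0 "\<lambda>u. h (u 0)"] H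
  by (simp add: smooth_function_def pd_def)

lemma smooth_function_deriv_0:
  assumes "open S" "smooth_function 0 S (\<lambda>u. h (u 0))"
  shows "smooth_function 0 S (\<lambda>u. deriv h (u 0))"
  using smooth_function_pd[OF assms, of 0] by (simp add: pd_def[abs_def])

lemma DxDx_order_0:
  assumes S: "open S" and H: "smooth_function 0 S (\<lambda>u. h (u 0))" and u: "u \<in> S"
  shows "Dx (Dx (\<lambda>u. h (u 0))) u = u 2 * deriv h (u 0) + (u 1)\<^sup>2 * deriv (deriv h) (u 0)"
proof -
  have H': "smooth_function 0 S (\<lambda>u. deriv h (u 0))"
    using S H by (rule smooth_function_deriv_0)
  have "Dx (Dx (\<lambda>u. h (u 0))) u = Dx (\<lambda>u. u 1 * deriv h (u 0)) u"
    using Dx_cong[OF S Dx_order_0[OF S H] u] .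
  also have "\<dots> = u 2 * deriv h (u 0) + u 1 * Dx (\<lambda>u. deriv h (u 0)) u"
    using Dx_mult[OF S u jet_smooth_coord jet_smoothI[OF H'], of 1] by simp
  finally show ?thesis
    unfolding Dx_order_0[OF S H' u] by (simp add: power2_eq_square)
qed

text \<open>
  The mixed derivative of \<open>f\<^sub>1\<^sub>1 f\<^sub>2\<^sub>2 - f\<^sub>1\<^sub>2 f\<^sub>2\<^sub>1\<close> with respect to \<open>z\<^sub>1\<close> and \<open>z\<^sub>2\<close> is a multiple of \<open>h'\<close>.
\<close>

lemma coeffs_II_wedge:
  assumes S: "open S" and h: "smooth_function 0 S (\<lambda>u. h (u 0))"
    and f: "coeffs_II S \<epsilon> \<alpha> \<beta> \<eta> (\<lambda>u. h (u 0)) f" and \<epsilon>: "\<epsilon> \<in> {1, -1}" and \<kappa>: "\<alpha> - \<epsilon> * \<beta> \<noteq> 0"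
  shows "(\<exists>u\<in>S. wedge f 1 2 u \<noteq> 0) \<longleftrightarrow> (\<exists>u\<in>S. deriv h (u 0) \<noteq> 0)"
proof -
  define k where "k = 1 / (\<alpha> - \<epsilon> * \<beta>)"
  have k: "k \<noteq> 0" and div: "x / (\<alpha> - \<epsilon> * \<beta>) = x * k" for x
    using \<kappa> by (simp_all add: k_def)
  \<comment> \<open>The wedge product with the total derivatives expanded; the terms containing
    \<eta> times \<open>h\<close> itself cancel.\<close>
  let ?W = "\<lambda>u. - \<eta> * k * (\<epsilon> * (u 2 * deriv h (u 0) + (u 1)\<^sup>2 * deriv (deriv h) (u 0))
      + \<eta> * (u 1 * deriv h (u 0))) + \<epsilon> * u 1 * deriv h (u 0) * (u 2 * k + \<beta>)"
  have W: "wedge f 1 2 u = ?W u" if u: "u \<in> S" for u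
  proof -
    have eqs: "f 1 1 u = \<eta>" "f 1 2 u = - \<epsilon> * Dx (\<lambda>u. h (u 0)) u - \<eta> * h (u 0)"
      "f 2 1 u = u 2 * k + \<beta>"
      "f 2 2 u = (- \<epsilon> * Dx (Dx (\<lambda>u. h (u 0))) u - \<eta> * Dx (\<lambda>u. h (u 0)) u) * k - (u 2 * k + \<beta>) * h (u 0)"
      using f[unfolded coeffs_II_def, rule_format, OF u] unfolding div by blast+
    show ?thesis
      unfolding wedge_def eqs Dx_order_0[OF S h u] DxDx_order_0[OF S h u] by (simp add: algebra_simps)
  qed
  show ?thesis
  proof
    assume "\<exists>u\<in>S. wedge f 1 2 u \<noteq> 0"
    then obtain u where u: "u \<in> S" "wedge f 1 2 u \<noteq> 0" by blast
    show "\<exists>u\<in>S. deriv h (u 0) \<noteq> 0"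
    proof (rule ccontr)
      assume "\<not> (\<exists>u\<in>S. deriv h (u 0) \<noteq> 0)"
      then have h0: "deriv h (w 0) = 0" if "w \<in> S" for w
        using that by blast
      \<comment> \<open>Since h' vanishes over \<open>S\<close>, \<open>Dx H\<close> vanishes on
        \<open>S\<close> and so does its total derivative; \<open>DxDx_order_0\<close> then removes
        the term with h''.\<close>
      have "Dx (Dx (\<lambda>u. h (u 0))) u = Dx (\<lambda>_. 0) u"
        by (rule Dx_cong[OF S _ u(1)]) (simp add: Dx_order_0[OF S h] h0)
      then have "(u 1)\<^sup>2 * deriv (deriv h) (u 0) = 0"
        using DxDx_order_0[OF S h u(1)] h0[OF u(1)] by simp
      then show False
        using W[OF u(1)] u(2) h0[OF u(1)] by simp
    qed
  next
    assume "\<exists>u\<in>S. deriv h (u 0) \<noteq> 0"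
    then obtain u where u: "u \<in> S" "deriv h (u 0) \<noteq> 0" by blast
    show "\<exists>u\<in>S. wedge f 1 2 u \<noteq> 0"
    proof (rule ccontr)
      assume "\<not> (\<exists>u\<in>S. wedge f 1 2 u \<noteq> 0)"
      then have W0: "?W w = 0" if "w \<in> S" for w
        using that W[OF that] by auto
      have pd2: "- \<eta> * k * \<epsilon> * deriv h (w 0) + \<epsilon> * w 1 * deriv h (w 0) * k = 0" if w: "w \<in> S" for w
      proof -
        have "pd 2 ?W w = - \<eta> * k * \<epsilon> * deriv h (w 0) + \<epsilon> * w 1 * deriv h (w 0) * k"
          by (rule pd_eqI) (auto intro!: derivative_eq_intros simp: algebra_simps)
        moreover have "pd 2 ?W w = pd 2 (\<lambda>_. 0) w"
          by (rule pd_cong[OF S W0 w])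
        ultimately show ?thesis
          by (simp add: pd_def)
      qed
      have "pd 1 (\<lambda>w. - \<eta> * k * \<epsilon> * deriv h (w 0) + \<epsilon> * w 1 * deriv h (w 0) * k) u =
          \<epsilon> * deriv h (u 0) * k"
        by (rule pd_eqI) (auto intro!: derivative_eq_intros)
      moreover have "pd 1 (\<lambda>w. - \<eta> * k * \<epsilon> * deriv h (w 0) + \<epsilon> * w 1 * deriv h (w 0) * k) u =
          pd 1 (\<lambda>_. 0) u"
        by (rule pd_cong[OF S pd2 u(1)])
      ultimately have "\<epsilon> * deriv h (u 0) * k = 0"
        by (simp add: pd_def)
      then show False
        using u(2) k \<epsilon> by auto
    qed
  qed
qed

lemma generically_nonzero_deriv_iff:
  assumes "open S" "smooth_function 0 S (\<lambda>u. h (u 0))"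
  shows "generically_nonzero S (\<lambda>u. deriv h (u 0)) \<longleftrightarrow> (\<exists>u\<in>S. deriv h (u 0) \<noteq> 0)"
  by (rule generically_nonzero_iff[OF assms(1) smooth_function_imp_continuous_on])
    (rule smooth_function_deriv_0[OF assms])

lemma form_II_imp_describes:
  assumes S: "open S" and f: "form_II S A B f"
  shows "pointwise_describes 1 S A B f \<and> conditions_f1 1 S f \<and> (\<exists>u\<in>S. wedge f 1 2 u \<noteq> 0)"
proof -
  obtain \<epsilon> \<alpha> \<beta> \<eta> h where *: "\<epsilon> \<in> {1, -1}" "\<alpha> - \<epsilon> * \<beta> \<noteq> 0" "smooth_function 0 S (\<lambda>u. h (u 0))"
      "generically_nonzero S (\<lambda>u. deriv h (u 0))" "coeffs_II S \<epsilon> \<alpha> \<beta> \<eta> (\<lambda>u. h (u 0)) f"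
    and G: "\<forall>u\<in>S. A u * u 3 + B u = - \<epsilon> * Dx (Dx (Dx (\<lambda>u. h (u 0)))) u
        - Dx (\<lambda>w. (w 2 + \<epsilon> * (\<alpha>\<^sup>2 - \<beta>\<^sup>2 - \<eta>\<^sup>2)) * h (w 0)) u - u 2 * Dx (\<lambda>u. h (u 0)) u"
    using f unfolding form_II_iff by blast
  have "pointwise_describes 1 S A B f"
    using coeffs_II_describes_iff[OF S jet_smoothI[OF *(3)] *(5,1,2)] G by blast
  moreover have "\<exists>u\<in>S. wedge f 1 2 u \<noteq> 0"
    using coeffs_II_wedge[OF S *(3,5,1,2)] generically_nonzero_deriv_iff[OF S *(3)] *(4) by blast
  ultimately show ?thesis
    using conditions_f1_standard[OF S coeffs_II_standard[OF *(5)] *(1)] by blast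
qed

text \<open>The wedge product can vanish identically only if \<open>a = 1\<close> and
  \<open>\<psi> = - b z\<^sub>2\<close>. Since \<open>A\<close> and \<open>B\<close> do not both
  vanish, \<open>b = 1\<close>, so the equation is \<open>z\<^sub>2\<^sub>t = - z\<^sub>3\<close>,
  which also has form (I) with \<open>a = b = 0\<close> and \<open>n = 1\<close>.\<close>

lemma form_I_with_nonzero_wedge:
  assumes U: "open U" and A: "smooth_function 2 (jets_over U) A" and B: "smooth_function 2 (jets_over U) B"
    and AB: "\<exists>u\<in>jets_over U. A u \<noteq> 0 \<or> B u \<noteq> 0" and f: "form_I (jets_over U) A B f"
  shows "\<exists>f. form_I (jets_over U) A B f \<and> (\<exists>u\<in>jets_over U. wedge f 1 2 u \<noteq> 0)"
proof (cases "\<exists>u\<in>jets_over U. wedge f 1 2 u \<noteq> 0")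
  case False
  let ?S = "jets_over U"
  have S: "open ?S"
    using U by (rule open_jets_over)
  obtain u0 where u0: "u0 \<in> ?S" "A u0 \<noteq> 0 \<or> B u0 \<noteq> 0"
    using AB by blast
  obtain \<epsilon> a b \<alpha> m n \<psi> where
    *: "\<epsilon> \<in> {1, -1}" "a \<in> {0, 1}" "b \<in> {0, 1}" "smooth_function 2 ?S \<psi>" "(a - 1) * b = 0"
      "coeffs_I ?S \<epsilon> a b \<alpha> m n \<psi> f"
      "generically_nonzero ?S (\<lambda>u. a * \<psi> u + b * u 2 + m\<^sup>2 + n\<^sup>2)"
    and G: "\<forall>u\<in>?S. A u * u 3 + B u = Dx \<psi> u + a * \<psi> u + b * u 2 + \<epsilon> * n * (1 - a) * \<alpha>"
    using f unfolding form_I_iff by blast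
  have W: "(if a = 1 then - \<epsilon> * (\<psi> u + b * u 2) else - (m * u 1 + n) * (u 2 + \<alpha>)) = 0"
    if "u \<in> ?S" for u
    using coeffs_I_wedge[OF *(6) that *(2,5)] False that by simp
  have other: "\<exists>w\<in>?S. w i \<noteq> x \<and> (\<forall>j. j \<noteq> i \<longrightarrow> w j = u j)" if u: "u \<in> ?S" for u i x
  proof (cases "u i = x")
    case True
    obtain s where "u(i := s) \<in> ?S" "s \<noteq> u i"
      using exists_other_upd_in[OF S u] .
    then show ?thesis
      using True by (intro bexI[of _ "u(i := s)"]) auto
  qed (use u in blast)
  have a: "a = 1"
  proof (rule ccontr)
    assume "a \<noteq> 1"
    then have "a = 0" "b = 0"
      using *(2,5) by auto
    then have mn: "m \<noteq> 0 \<or> n \<noteq> 0"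
      using *(7) by (auto simp: generically_nonzero_def)
    obtain v where v: "v \<in> ?S" "v 2 \<noteq> - \<alpha>"
      using other[OF u0(1), of 2 "- \<alpha>"] by blast
    \<comment> \<open>For \<open>m = 0\<close> the excluded value is 0 by the convention on
      division; in that case \<open>m * w 1 + n = 0\<close> directly gives
      \<open>n = 0\<close>.\<close>
    obtain w where w: "w \<in> ?S" "w 1 \<noteq> - n / m" "w 2 = v 2"
      using other[OF v(1), of 1 "- n / m"] by fastforce
    have "m * w 1 + n = 0"
      using W[OF w(1)] \<open>a \<noteq> 1\<close> v(2) w(3) by (auto simp: add_eq_0_iff2)
    moreover from this have "m = 0"
      using w(2) by (metis add_eq_0_iff2 mult.commute nonzero_eq_divide_eq)
    ultimately show False
      using mn by simp
  qed
  have \<psi>: "\<psi> u = - b * u 2" if "u \<in> ?S" for u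
    using W[OF that] a *(1) by auto
  have "Dx \<psi> u = - b * u 3" if u: "u \<in> ?S" for u
  proof -
    have "Dx \<psi> u = Dx (\<lambda>u. - b * u 2) u"
      by (rule Dx_cong[OF S \<psi> u])
    then show ?thesis
      by (simp add: Dx_rules[OF S u] jet_smooth_intros S)
  qed
  then have G': "A u * u 3 + B u = - b * u 3" if "u \<in> ?S" for u
    using G a that \<psi> by simp
  have b: "b = 1"
  proof (rule ccontr)
    assume "b \<noteq> 1"
    then have "b = 0"
      using *(3) by simp
    \<comment> \<open>z_3 is unrestricted over \<open>U\<close>, while \<open>A\<close> and
      \<open>B\<close> ignore it, so an affine function of z_3 vanishes identically and both its
      coefficients are zero.\<close>
    have in_S: "u0(3 := x) \<in> ?S" for x
      using u0(1) by (simp add: jets_over_def)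
    have "A (u0(3 := x)) = A u0" "B (u0(3 := x)) = B u0" for x
      using A B in_S u0(1) by (auto simp: smooth_function_def elim!: depends_uptoD)
    then have "A u0 * x + B u0 = 0" for x
      using G'[OF in_S, of x] \<open>b = 0\<close> by simp
    from this[of 0] this[of 1] show False
      using u0(2) by simp
  qed
  \<comment> \<open>The replacement has \<open>\<omega>\<^sub>1 = dt\<close> and
    \<open>\<omega>\<^sub>2 = \<omega>\<^sub>3 = z\<^sub>2 dx - (z\<^sub>2 + z\<^sub>1) dt\<close>;
    its wedge product is \<open>- z\<^sub>2\<close>.\<close>
  define f' :: "nat \<Rightarrow> nat \<Rightarrow> jet \<Rightarrow> real" where
    "f' i j u = (if j = 1 then if i = 1 then 0 else u 2 else if i = 1 then 1 else - u 2 - u 1)" for i j u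
  have f': "coeffs_I ?S 1 0 0 0 0 1 (\<lambda>u. - u 2) f'"
    by (simp add: coeffs_I_def f'_def)
  obtain w where w: "w \<in> ?S" "w 2 \<noteq> 0"
    using other[OF u0(1), of 2 0] by blast
  have sm: "smooth_function 2 ?S (\<lambda>u. - u 2)"
    by (intro smooth_function_intros S order_refl)
  have wedge: "\<exists>u\<in>?S. wedge f' 1 2 u \<noteq> 0"
    using w by (intro bexI[of _ w]) (simp_all add: wedge_def f'_def)
  have "\<forall>u\<in>?S. A u * u 3 + B u = Dx (\<lambda>u. - u 2) u + 0 * - u 2 + 0 * u 2 + 1 * 1 * (1 - 0) * 0"
  proof
    fix u assume u: "u \<in> ?S"
    show "A u * u 3 + B u = Dx (\<lambda>u. - u 2) u + 0 * - u 2 + 0 * u 2 + 1 * 1 * (1 - 0) * 0"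
      using G'[OF u] b by (simp add: Dx_rules[OF S u] jet_smooth_intros S)
  qed
  then have "pointwise_describes 1 ?S A B f'"
    by (subst coeffs_I_describes_iff[OF S sm f']) simp_all
  then have "form_I ?S A B f'"
    using wedge by (intro form_I_intro[OF S f' sm]) simp_all
  then show ?thesis
    using wedge by blast
qed (use f in blast)

section \<open>Reduction to the two forms\<close>

context standard_description
begin

text \<open>With \<kappa> nonzero, \<open>H = - g / \<kappa>\<close> determines everything:
  \<open>Dx_g\<close> yields \<open>f 1 2\<close>, then \<open>Dx_f12\<close> yields
  \<open>f 2 2\<close>, and the definition of \<open>g\<close> yields \<open>f 3 2\<close>. The
  normalization \<open>q * \<kappa> = 1\<close> matches the leading coefficient in form
  (II).\<close>

lemma nondegenerate_case:
  assumes \<kappa>: "q * \<kappa> = 1" and wedge: "\<exists>u\<in>S. wedge f 1 2 u \<noteq> 0"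
  shows "form_II S A B f"
proof -
  have \<kappa>0: "\<kappa> \<noteq> 0"
    using \<kappa> by auto
  then have q_eq: "q = 1 / \<kappa>"
    using \<kappa> by (rule nonzero_eq_divide_eq[THEN iffD2])
  \<comment> \<open>\<open>g\<close> is a function on jets, whereas form (II) asks for a function of
    one real variable. Any jet of \<open>S\<close> over \<open>z\<close> serves as representative,
    because \<open>g\<close> has order 0.\<close>
  define h where "h z = - g (SOME u. u \<in> S \<and> u 0 = z) / \<kappa>" for z
  define H where "H = (\<lambda>u :: jet. h (u 0))"
  have dep: "depends_upto 0 S g"
    using g_order_0 by (simp add: smooth_function_def)
  have H_eq: "H u = - g u / \<kappa>" if u: "u \<in> S" for u
  proof -
    let ?w = "SOME w. w \<in> S \<and> w 0 = u 0"
    have "?w \<in> S \<and> ?w 0 = u 0"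
      by (rule someI[of _ u]) (use u in simp)
    then have "g ?w = g u"
      using u by (intro depends_uptoD[OF dep]) auto
    then show ?thesis
      by (simp add: H_def h_def)
  qed
  have gH: "g u = - \<kappa> * H u" if u: "u \<in> S" for u
  proof -
    have "\<kappa> * H u = - g u"
      using \<kappa>0 H_eq[OF u] by simp
    then show ?thesis
      by linarith
  qed
  have smH: "smooth_function 0 S H"
  proof (rule smooth_function_cong[OF open_S])
    show "smooth_function 0 S (\<lambda>u. - g u / \<kappa>)"
      by (intro smooth_function_intros open_S g_order_0)
  qed (simp add: H_eq)
  note js = jet_smooth_intros open_S jet_smoothI[OF smH] jet_smoothI[OF g_order_0]
  have DxH: "Dx H u = - Dx g u / \<kappa>" if u: "u \<in> S" for u
  proof -
    have "Dx H u = Dx (\<lambda>u. - g u / \<kappa>) u"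
      by (rule Dx_cong[OF open_S H_eq u])
    then show ?thesis
      by (simp add: Dx_rules[OF open_S u] js)
  qed
  have f12: "f 1 2 u = - \<epsilon> * Dx H u - \<eta> * H u" if u: "u \<in> S" for u
  proof -
    \<comment> \<open>Multiplying by \<epsilon> isolates \<open>\<kappa> * f 1 2 u\<close>, since
      \<epsilon> squares to 1.\<close>
    have "\<epsilon> * (\<kappa> * Dx H u) = \<epsilon> * - (\<epsilon> * \<kappa> * f 1 2 u - \<epsilon> * \<eta> * g u)"
      using \<kappa>0 DxH[OF u] Dx_g[OF u] by simp
    moreover note gH[OF u]
    ultimately have "\<kappa> * f 1 2 u = \<kappa> * (- \<epsilon> * Dx H u - \<eta> * H u)"
      using eps_sq(1) by algebra
    then show ?thesis
      using \<kappa>0 by simp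
  qed
  have Dxf12: "Dx (f 1 2) u = - \<epsilon> * Dx (Dx H) u - \<eta> * Dx H u" if u: "u \<in> S" for u
  proof -
    have "Dx (f 1 2) u = Dx (\<lambda>u. - \<epsilon> * Dx H u - \<eta> * H u) u"
      by (rule Dx_cong[OF open_S f12 u])
    then show ?thesis
      by (simp add: Dx_rules[OF open_S u] js)
  qed
  have f22: "f 2 2 u = (- \<epsilon> * Dx (Dx H) u - \<eta> * Dx H u) / \<kappa> - (u 2 / \<kappa> + r) * H u"
    if u: "u \<in> S" for u
  proof -
    have "\<kappa> * f 2 2 u = Dx (f 1 2) u + g u * (q * u 2 + r)"
      using Dx_f12[OF u] by simp
    also note gH[OF u]
    finally have "f 2 2 u * \<kappa> = Dx (f 1 2) u - \<kappa> * H u * (q * u 2 + r)"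
      by (simp add: algebra_simps)
    then have "f 2 2 u = (Dx (f 1 2) u - \<kappa> * H u * (q * u 2 + r)) / \<kappa>"
      by (rule nonzero_eq_divide_eq[OF \<kappa>0, THEN iffD2])
    then show ?thesis
      using \<kappa>0 unfolding Dxf12[OF u] q_eq by (simp add: diff_divide_distrib mult.commute)
  qed
  have f32: "f 3 2 u = (- Dx (Dx H) u - \<epsilon> * \<eta> * Dx H u) / \<kappa> - \<epsilon> * (u 2 / \<kappa> + \<epsilon> * s) * H u"
    if u: "u \<in> S" for u
  proof -
    have "f 3 2 u = \<epsilon> * f 2 2 u + g u"
      by (simp add: g_def)
    also note gH[OF u]
    finally show ?thesis
      unfolding f22[OF u] by (simp add: algebra_simps add_divide_distrib diff_divide_distrib)
  qed
  have coeffs: "coeffs_II S \<epsilon> s r \<eta> H f"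
    unfolding coeffs_II_def
  proof (intro ballI conjI)
    fix u assume u: "u \<in> S"
    show "f 1 1 u = \<eta>" "f 2 1 u = u 2 / \<kappa> + r" "f 3 1 u = \<epsilon> * u 2 / \<kappa> + s"
      using std u unfolding standard_forms_def q_eq by simp_all
  qed (fact f12 f22 f32)+
  have "\<forall>u\<in>S. A u * u 3 + B u = - \<epsilon> * Dx (Dx (Dx H)) u
        - Dx (\<lambda>w. (w 2 + \<epsilon> * (s\<^sup>2 - r\<^sup>2 - \<eta>\<^sup>2)) * H w) u - u 2 * Dx H u"
    using coeffs_II_describes_iff[OF open_S jet_smoothI[OF smH] coeffs \<epsilon> \<kappa>0] pd_f by blast
  moreover have "\<exists>u\<in>S. deriv h (u 0) \<noteq> 0"
    using coeffs_II_wedge[OF open_S smH[unfolded H_def] coeffs[unfolded H_def] \<epsilon> \<kappa>0] wedge by blast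
  ultimately show ?thesis
    unfolding form_II_iff using coeffs smH \<kappa>0 generically_nonzero_deriv_iff[OF open_S smH[unfolded H_def]]
    unfolding H_def
    by (intro bexI[OF _ \<epsilon>] exI[of _ s] exI[of _ r] exI[of _ \<eta>] exI[of _ h] conjI) simp_all
qed

end

section \<open>Normalization by scaling\<close>

lemma (in coordinate_transformation) smooth_function_transform:
  assumes "open S" "smooth_function k S F"
  shows "smooth_function k (dom' S) (A' F)" "smooth_function k (dom' S) (B' F)"
proof -
  have sm: "smooth_function k (dom' S) (\<lambda>u. F (old u))"
    using assms by (rule smooth_function_old_jet)
  show "smooth_function k (dom' S) (A' F)" "smooth_function k (dom' S) (B' F)"
    unfolding transform_A_def[abs_def] transform_B_def[abs_def]
    by (rule smooth_function_mult[OF open_transform_dom[OF assms(1)] smooth_function_const sm])+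
qed

text \<open>Without a shift the domain becomes a preimage under a linear map, so it stays convex.
  The leading coefficient \<open>q\<close> scales by \<open>a / c\<close> and the other parameters
  by \<open>1 / a\<close>, which leaves room to normalize both.\<close>

lemma standard_description_transform:
  assumes "coordinate_transformation a b c" and "standard_description U A B f \<epsilon> \<eta> q r s"
  obtains U' where "transform_dom a c 0 (jets_over U) = jets_over U'"
    "standard_description U' (transform_A a b c 0 A) (transform_B a b c 0 B) (transform_forms a b c 0 f)
      \<epsilon> (\<eta> / a) (q * a / c) (r / a) (s / a)"
proof -
  interpret T: coordinate_transformation a b c 0
    by fact
  interpret D: standard_description U A B f \<epsilon> \<eta> q r s
    by fact
  define L where "L = (\<lambda>(x, y, z). (x / c, a * y / c, a\<^sup>2 * z / c) :: real \<times> real \<times> real)"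
  have dom: "transform_dom a c 0 (jets_over U) = jets_over (L -` U)"
    by (auto simp: L_def transform_dom_def jets_over_def old_jet_def)
  have linear: "linear L"
    by (rule linearI) (auto simp: L_def add_divide_distrib distrib_left)
  have T: "open (transform_dom a c 0 (jets_over U))"
    using D.open_S by (rule open_transform_dom)
  have "standard_description (L -` U) (T.A' A) (T.B' B) (T.forms' f) \<epsilon> (\<eta> / a) (q * a / c) (r / a) (s / a)"
  proof
    show "open (L -` U)"
      using linear_continuous_on[OF linear[THEN linear_conv_bounded_linear[THEN iffD1]], of UNIV] D.U(1)
      by (rule open_vimage[rotated])
    show "convex (L -` U)"
      using linear D.U(2) by (rule convex_linear_vimage)
    obtain x y z where "(x, y, z) \<in> U"
      using D.U(3) by auto
    then have "(c * x, c * y / a, c * z / a\<^sup>2) \<in> L -` U"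
      using T.nonzero by (simp add: L_def)
    then show "L -` U \<noteq> {}"
      by blast
    show "smooth_function 2 (jets_over (L -` U)) (T.A' A)" "smooth_function 2 (jets_over (L -` U)) (T.B' B)"
      unfolding dom[symmetric]
      by (rule T.smooth_function_transform[OF D.open_S D.A] T.smooth_function_transform[OF D.open_S D.B])+
    show "pointwise_describes 1 (jets_over (L -` U)) (T.A' A) (T.B' B) (T.forms' f)"
      unfolding dom[symmetric] using D.open_S D.pd_f by (rule T.pointwise_describes_transform)
    show "standard_forms (jets_over (L -` U)) \<epsilon> (\<eta> / a) (q * a / c) (r / a) (s / a) (T.forms' f)"
      unfolding dom[symmetric] standard_forms_def
    proof
      fix u assume "u \<in> transform_dom a c 0 (jets_over U)"
      then have "old_jet a c 0 u \<in> jets_over U"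
        by (simp add: transform_dom_def)
      then have eqs: "f 1 1 (old_jet a c 0 u) = \<eta>" "f 2 1 (old_jet a c 0 u) = q * old_jet a c 0 u 2 + r"
        "f 3 1 (old_jet a c 0 u) = \<epsilon> * q * old_jet a c 0 u 2 + s"
        using D.std unfolding standard_forms_def by blast+
      show "T.forms' f 1 1 u = \<eta> / a \<and> T.forms' f 2 1 u = q * a / c * u 2 + r / a \<and>
          T.forms' f 3 1 u = \<epsilon> * (q * a / c) * u 2 + s / a"
        using T.nonzero
        by (simp add: transform_forms_def eqs add_divide_distrib) (simp add: old_jet_def power2_eq_square)
    qed
    show "\<epsilon> \<in> {1, -1}"
      by (rule D.\<epsilon>)
    show "q * a / c \<noteq> 0"
      using D.q T.nonzero by simp
  qed
  then show thesis
    using that dom by blast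
qed

lemma canonical_formI:
  assumes "a * b * c \<noteq> 0"
    and "form_I (transform_dom a c c0 S) (transform_A a b c c0 A) (transform_B a b c c0 B)
        (transform_forms a b c c0 f) \<or>
      form_II (transform_dom a c c0 S) (transform_A a b c c0 A) (transform_B a b c c0 B)
        (transform_forms a b c c0 f)"
  shows "canonical_form 1 S A B f"
  unfolding canonical_form_def Let_def using assms by blast

text \<open>If \<kappa> is nonzero, scaling z leads to form (II). Otherwise form (I) arises, with
  \<open>a = 1\<close> or \<open>a = 0\<close> according to whether \<eta> is nonzero.\<close>

lemma standard_description_imp_canonical:
  assumes D: "standard_description U A B f \<epsilon> \<eta> q r s" and wedge: "\<exists>u\<in>jets_over U. wedge f 1 2 u \<noteq> 0"
  shows "canonical_form 1 (jets_over U) A B f"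
proof -
  interpret D: standard_description U A B f \<epsilon> \<eta> q r s
    by fact
  have wedge': "\<exists>u\<in>transform_dom a c 0 D.S. wedge (transform_forms a b c 0 f) 1 2 u \<noteq> 0"
    if "coordinate_transformation a b c" for a b c
  proof -
    interpret T: coordinate_transformation a b c 0
      by fact
    obtain u where "u \<in> D.S" "wedge f 1 2 u \<noteq> 0"
      using wedge by blast
    then show ?thesis
      using T.nonzero T.old_new[of u]
      by (intro bexI[of _ "T.new u"]) (simp_all add: T.wedge_transform transform_dom_def)
  qed
  show ?thesis
  proof (cases "D.\<kappa> = 0")
    case False
    \<comment> \<open>Scaling z alone keeps \<kappa> and turns \<open>q\<close> into
      \<open>q / c\<close>, the reciprocal of \<kappa>.\<close>
    define c where "c = q * D.\<kappa>"
    have c: "c \<noteq> 0"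
      using False D.q by (simp add: c_def)
    then have T: "coordinate_transformation 1 1 c"
      by unfold_locales auto
    obtain U' where U': "transform_dom 1 c 0 D.S = jets_over U'"
      "standard_description U' (transform_A 1 1 c 0 A) (transform_B 1 1 c 0 B) (transform_forms 1 1 c 0 f)
        \<epsilon> (\<eta> / 1) (q * 1 / c) (r / 1) (s / 1)"
      using standard_description_transform[OF T D] .
    have "q * 1 / c * (s / 1 - \<epsilon> * (r / 1)) = 1"
      using False D.q by (simp add: c_def)
    from standard_description.nondegenerate_case[OF U'(2) this] wedge'[OF T]
    have "form_II (transform_dom 1 c 0 D.S) (transform_A 1 1 c 0 A) (transform_B 1 1 c 0 B)
        (transform_forms 1 1 c 0 f)"
      unfolding U'(1) by blast
    then show ?thesis
      using c by (intro canonical_formI[of 1 1 c 0]) auto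
  next
    case True
    obtain g0 w0 where f32: "\<forall>u\<in>D.S. f 3 2 u = \<epsilon> * f 2 2 u + g0"
      and f12: "\<forall>u\<in>D.S. f 1 2 u = - g0 * q * u 1 + w0" and g0: "\<eta> * g0 = 0" "g0 * r = 0"
      using D.degenerate_case[OF True] .
    have s: "s = \<epsilon> * r"
      using True by simp
    \<comment> \<open>Common to both values of \<open>a\<close> in form (I). Here \<open>a'\<close>,
      \<open>b'\<close> are the parameters of the form and \<open>a\<close>, \<open>b\<close>,
      \<open>c\<close> the scaling factors; \<open>c = q * a\<close> makes the coefficient of z_2
      equal to 1.\<close>
    have form_I: "form_I (transform_dom a c 0 D.S) (transform_A a b c 0 A) (transform_B a b c 0 B)
        (transform_forms a b c 0 f)"
      if T: "coordinate_transformation a b c" and c: "c = q * a" and a': "a' \<in> {0, 1}" "b' \<in> {0, 1}"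
        and eqs: "\<eta> / a = - \<epsilon> * a'" "(a' - 1) * (r / a) * m = 0" "(a' - 1) * b' = 0"
          "a' = 1 \<Longrightarrow> m = 0 \<and> n = 0" "g0 / b = - (1 - a') * m" "w0 / b = (1 - a') * n + \<epsilon> * b'"
      for a b c a' b' m n
    proof -
      let ?S = "transform_dom a c 0 D.S" and ?f = "transform_forms a b c 0 f"
      interpret T: coordinate_transformation a b c 0
        by fact
      obtain U' where U': "?S = jets_over U'"
        "standard_description U' (transform_A a b c 0 A) (transform_B a b c 0 B) ?f
          \<epsilon> (\<eta> / a) (q * a / c) (r / a) (s / a)"
        using standard_description_transform[OF T D] .
      interpret D': standard_description U' "transform_A a b c 0 A" "transform_B a b c 0 B" ?f
          \<epsilon> "\<eta> / a" "q * a / c" "r / a" "s / a"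
        by fact
      have qac: "q * a / c = 1"
        using c D.q T.nonzero by simp
      \<comment> \<open>The formula for \<open>f 2 2\<close> in form (I) is solved for \<psi>;
        nothing else restricts \<open>f 2 2\<close>.\<close>
      define \<psi> where "\<psi> u = ?f 2 2 u + (\<epsilon> * (1 - a') * (m / 2 * (u 1)\<^sup>2 + n * u 1) + r / a * b')" for u
      have S: "open ?S"
        using D.open_S by (rule open_transform_dom)
      have \<psi>: "smooth_function 2 ?S \<psi>"
        unfolding \<psi>_def[abs_def] using D'.f_order_2(2) unfolding U'(1)
        by (intro smooth_function_intros D'.open_S) auto
      have "coeffs_I ?S \<epsilon> a' b' (r / a) m n \<psi> ?f"
        unfolding coeffs_I_def
      proof (intro ballI conjI)
        fix u assume u: "u \<in> ?S"
        then have old: "T.old u \<in> D.S"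
          by (simp add: transform_dom_def)
        have std: "?f 1 1 u = \<eta> / a" "?f 2 1 u = q * a / c * u 2 + r / a"
          "?f 3 1 u = \<epsilon> * (q * a / c) * u 2 + s / a"
          using D'.std u unfolding U'(1) standard_forms_def by blast+
        show "?f 1 1 u = - \<epsilon> * a'"
          using std(1) eqs(1) by simp
        show "?f 2 1 u = u 2 + r / a"
          using std(2) qac by simp
        then show "?f 3 1 u = \<epsilon> * ?f 2 1 u"
          using std(3) qac s by (simp add: distrib_left)
        have "?f 1 2 u = - (g0 / b) * (q * T.old u 1) + w0 / b"
          using bspec[OF f12 old] by (simp add: transform_forms_def diff_divide_distrib)
        also have "q * T.old u 1 = u 1"
          using c D.q T.nonzero by (simp add: old_jet_def)
        finally show "?f 1 2 u = (1 - a') * (m * u 1 + n) + \<epsilon> * b'"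
          unfolding eqs(5,6) by (simp add: algebra_simps)
        show "?f 2 2 u = \<psi> u - \<epsilon> * (1 - a') * (m / 2 * (u 1)\<^sup>2 + n * u 1) - r / a * b'"
          by (simp add: \<psi>_def)
        have "?f 3 2 u = \<epsilon> * ?f 2 2 u + g0 / b"
          using bspec[OF f32 old] by (simp add: transform_forms_def add_divide_distrib)
        then show "?f 3 2 u = \<epsilon> * ?f 2 2 u - (1 - a') * m"
          unfolding eqs(5) by (simp add: algebra_simps)
      qed
      from form_I_intro[OF S this \<psi> D.\<epsilon> a' eqs(2,3) _ wedge'[OF T] eqs(4)] show ?thesis
        using D'.pd_f unfolding U'(1) by blast
    qed
    show ?thesis
    proof (cases "\<eta> = 0")
      case False
      \<comment> \<open>The choice of \<open>a\<close> turns \<eta> into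
        \<open>- \<epsilon>\<close>. The choice of \<open>b\<close> turns a nonzero
        \<open>w0\<close> into \<epsilon>, so that \<open>b' = 1\<close>; for \<open>w0 = 0\<close>
        the variable \<open>t\<close> is kept and \<open>b' = 0\<close>.\<close>
      define a where "a = - \<epsilon> * \<eta>"
      define b where "b = (if w0 = 0 then 1 else \<epsilon> * w0)"
      have nz: "a \<noteq> 0" "b \<noteq> 0" "q * a \<noteq> 0" and \<epsilon>: "\<epsilon> = 1 \<or> \<epsilon> = -1"
        using False D.\<epsilon> D.q by (auto simp: a_def b_def)
      then have T: "coordinate_transformation a b (q * a)"
        by unfold_locales
      have "form_I (transform_dom a (q * a) 0 D.S) (transform_A a b (q * a) 0 A)
          (transform_B a b (q * a) 0 B) (transform_forms a b (q * a) 0 f)"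
      proof (rule form_I[where a' = 1 and b' = "if w0 = 0 then 0 else 1" and m = 0 and n = 0, OF T refl])
        show "\<eta> / a = - \<epsilon> * 1"
          using \<epsilon> False by (auto simp: a_def)
        show "g0 / b = - (1 - 1) * 0"
          using g0(1) False by simp
        show "w0 / b = (1 - 1) * 0 + \<epsilon> * (if w0 = 0 then 0 else 1)"
          using \<epsilon> by (auto simp: b_def)
      qed simp_all
      then show ?thesis
        using nz by (intro canonical_formI[of a b "q * a" 0]) simp_all
    next
      case True
      \<comment> \<open>With \<open>a' = b' = 0\<close> only z is scaled; \<open>g0 * r = 0\<close>
        becomes the constraint on \<alpha> and \<open>m\<close>.\<close>
      have T: "coordinate_transformation 1 1 q"
        using D.q by unfold_locales auto
      have "form_I (transform_dom 1 q 0 D.S) (transform_A 1 1 q 0 A)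
          (transform_B 1 1 q 0 B) (transform_forms 1 1 q 0 f)"
        by (rule form_I[where a' = 0 and b' = 0 and m = "- g0" and n = w0, OF T])
          (use True g0(2) in \<open>simp_all add: disj_commute\<close>)
      then show ?thesis
        using D.q by (intro canonical_formI[of 1 1 q 0]) simp_all
    qed
  qed
qed

section \<open>From the canonical forms back to surfaces\<close>

lemma canonical_imp_describes:
  assumes S: "open S" and f: "canonical_form \<delta> S A B f"
  shows "\<delta> = 1 \<and> pointwise_describes \<delta> S A B f \<and> conditions_f1 \<delta> S f"
proof -
  obtain a b c c0 where \<delta>: "\<delta> = 1" and abc: "a * b * c \<noteq> 0" and
    f: "form_I (transform_dom a c c0 S) (transform_A a b c c0 A) (transform_B a b c c0 B)
        (transform_forms a b c c0 f) \<or>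
      form_II (transform_dom a c c0 S) (transform_A a b c c0 A) (transform_B a b c c0 B)
        (transform_forms a b c c0 f)"
    using f unfolding canonical_form_def Let_def by blast
  interpret T: coordinate_transformation a b c c0
    using abc by unfold_locales auto
  \<comment> \<open>The properties hold in the new coordinates by the lemmas on the two forms, and
    the inverse transformation carries them back.\<close>
  interpret I: coordinate_transformation "1 / a" "1 / b" "1 / c" "- (c0 / c)"
    by (rule T.inverse)
  have S': "open (T.dom' S)"
    using S by (rule open_transform_dom)
  have "pointwise_describes 1 (T.dom' S) (T.A' A) (T.B' B) (T.forms' f)"
    and c: "conditions_f1 1 (T.dom' S) (T.forms' f)"
    using f form_I_imp_describes[OF S'] form_II_imp_describes[OF S'] by blast+
  note d = this(1)
  then have "smooth_forms (T.dom' S) (T.forms' f)"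
    by (simp add: pointwise_describes_def)
  from I.pointwise_describes_transform[OF S' d] I.conditions_f1_transform[OF S' this c] show ?thesis
    by (simp only: \<delta> T.dom_inv_dom T.A_inv_A T.B_inv_B T.forms_inv_forms simp_thms)
qed

text \<open>Suitable forms \<open>F\<close> are found in the new coordinates and pulled back with
  \<open>forms_inv\<close>, whose transform is \<open>F\<close> again. In form (II) the given ones
  already work, because h' is not identically zero.\<close>

lemma canonical_with_nonzero_wedge:
  assumes U: "open U" and A: "smooth_function 2 (jets_over U) A" and B: "smooth_function 2 (jets_over U) B"
    and AB: "generically_nonzero (jets_over U) (\<lambda>u. (A u)\<^sup>2 + (B u)\<^sup>2)"
    and f: "canonical_form \<delta> (jets_over U) A B f"
  shows "\<exists>f. canonical_form \<delta> (jets_over U) A B f \<and> (\<exists>u\<in>jets_over U. wedge f 1 2 u \<noteq> 0)"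
proof -
  let ?S = "jets_over U"
  have S: "open ?S"
    using U by (rule open_jets_over)
  obtain a b c c0 where \<delta>: "\<delta> = 1" and abc: "a * b * c \<noteq> 0" and
    f: "form_I (transform_dom a c c0 ?S) (transform_A a b c c0 A) (transform_B a b c c0 B)
        (transform_forms a b c c0 f) \<or>
      form_II (transform_dom a c c0 ?S) (transform_A a b c c0 A) (transform_B a b c c0 B)
        (transform_forms a b c c0 f)"
    using f unfolding canonical_form_def Let_def by blast
  interpret T: coordinate_transformation a b c c0
    using abc by unfold_locales auto
  have S': "open (T.dom' ?S)"
    using S by (rule open_transform_dom)
  obtain F where F: "form_I (T.dom' ?S) (T.A' A) (T.B' B) F \<or> form_II (T.dom' ?S) (T.A' A) (T.B' B) F"
    "\<exists>u\<in>T.dom' ?S. wedge F 1 2 u \<noteq> 0"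
    using f
  proof
    assume f: "form_I (T.dom' ?S) (T.A' A) (T.B' B) (T.forms' f)"
    define U' where "U' = (\<lambda>(x, y, z). ((x - c0) / c, a * y / c, a\<^sup>2 * z / c)) -` U"
    have dom: "T.dom' ?S = jets_over U'"
      unfolding U'_def by (rule transform_dom_jets_over)
    have "continuous_on UNIV (\<lambda>(x, y, z). ((x - c0) / c, a * y / c, a\<^sup>2 * z / c))"
      unfolding case_prod_beta divide_inverse by (intro continuous_intros)
    then have U': "open U'"
      unfolding U'_def using U by (intro open_vimage)
    have sm: "smooth_function 2 (T.dom' ?S) (T.A' A)" "smooth_function 2 (T.dom' ?S) (T.B' B)"
      by (rule T.smooth_function_transform[OF S A] T.smooth_function_transform[OF S B])+
    obtain u where u: "u \<in> ?S" "A u \<noteq> 0 \<or> B u \<noteq> 0"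
      using AB unfolding generically_nonzero_def by fastforce
    have "\<exists>u\<in>T.dom' ?S. T.A' A u \<noteq> 0 \<or> T.B' B u \<noteq> 0"
      using u T.nonzero
      by (intro bexI[of _ "T.new u"]) (auto simp: transform_A_def transform_B_def transform_dom_def)
    then show thesis
      using form_I_with_nonzero_wedge[OF U', of "T.A' A" "T.B' B" "T.forms' f"] sm f that
      unfolding dom by blast
  next
    assume "form_II (T.dom' ?S) (T.A' A) (T.B' B) (T.forms' f)"
    then show thesis
      using form_II_imp_describes[OF S'] that by blast
  qed
  have "canonical_form \<delta> ?S A B (T.forms_inv F)"
    unfolding \<delta> by (rule canonical_formI[OF abc, of c0]) (simp add: F(1))
  moreover have "\<exists>u\<in>?S. wedge (T.forms_inv F) 1 2 u \<noteq> 0"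
  proof -
    obtain u where "u \<in> T.dom' ?S" "wedge F 1 2 u \<noteq> 0"
      using F(2) by blast
    then show ?thesis
      using T.nonzero T.wedge_transform[of "T.forms_inv F" 1 2 u]
      by (intro bexI[of _ "T.old u"]) (auto simp: transform_dom_def)
  qed
  ultimately show ?thesis
    by blast
qed

text \<open>The first conjunct speaks of the equation alone, the second of individual coefficients
  \<open>f\<close>. The latter carries the wedge condition because form (I) includes coefficients
  with vanishing wedge product, which describe no surface;
  \<open>canonical_with_nonzero_wedge\<close> links the two.\<close>

theorem theorem3p4:
  fixes \<delta> :: real
    and U :: "(real \<times> real \<times> real) set"
    and A B :: "jet \<Rightarrow> real"
  assumes "\<delta> = 1 \<or> \<delta> = -1"
    and "open U" and "convex U" and "U \<noteq> {}"
    and "smooth_function 2 (jets_over U) A"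
    and "smooth_function 2 (jets_over U) B"
    and "generically_nonzero (jets_over U) (\<lambda>u. (A u)\<^sup>2 + (B u)\<^sup>2)"
  shows "((\<exists>f. describes \<delta> (jets_over U) A B f \<and> conditions_f1 \<delta> (jets_over U) f) \<longleftrightarrow>
          (\<exists>f. canonical_form \<delta> (jets_over U) A B f)) \<and>
         (\<forall>f. describes \<delta> (jets_over U) A B f \<and> conditions_f1 \<delta> (jets_over U) f \<longleftrightarrow>
              canonical_form \<delta> (jets_over U) A B f \<and>
              generically_nonzero (jets_over U) (wedge f 1 2))"
proof -
  let ?S = "jets_over U"
  have S: "open ?S"
    using assms(2) by (rule open_jets_over)
  have iff: "describes \<delta> ?S A B f \<and> conditions_f1 \<delta> ?S f \<longleftrightarrow>
      canonical_form \<delta> ?S A B f \<and> generically_nonzero ?S (wedge f 1 2)" for f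
  proof
    assume L: "describes \<delta> ?S A B f \<and> conditions_f1 \<delta> ?S f"
    then have d: "pointwise_describes \<delta> ?S A B f" "generically_nonzero ?S (wedge f 1 2)"
      by (simp_all add: describes_iff_pointwise[OF assms(2,5,6)])
    then obtain u where u: "u \<in> ?S" "wedge f 1 2 u \<noteq> 0"
      unfolding generically_nonzero_def by blast
    obtain \<epsilon> \<eta> q r s where std: "\<delta> = 1" "\<epsilon> \<in> {1, -1}" "q \<noteq> 0" "standard_forms ?S \<epsilon> \<eta> q r s f"
      using standard_forms_exist[OF assms(1) S u(1) d(1) conjunct2[OF L]] .
    have "standard_description U A B f \<epsilon> \<eta> q r s"
      using d(1) by (intro standard_description.intro assms std) (simp add: std(1))
    then have "canonical_form \<delta> ?S A B f"
      unfolding std(1) by (rule standard_description_imp_canonical) (use u in blast)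
    then show "canonical_form \<delta> ?S A B f \<and> generically_nonzero ?S (wedge f 1 2)"
      using d(2) by blast
  next
    assume R: "canonical_form \<delta> ?S A B f \<and> generically_nonzero ?S (wedge f 1 2)"
    then have "pointwise_describes \<delta> ?S A B f \<and> conditions_f1 \<delta> ?S f"
      using canonical_imp_describes[OF S] by blast
    with R show "describes \<delta> ?S A B f \<and> conditions_f1 \<delta> ?S f"
      by (simp only: describes_iff_pointwise[OF assms(2,5,6)] simp_thms)
  qed
  \<comment> \<open>The condition on \<open>A\<close> and \<open>B\<close> enters here: forms with
    vanishing wedge product may have to be exchanged for others of the same equation.\<close>
  have nonzero: "\<exists>f. canonical_form \<delta> ?S A B f \<and> generically_nonzero ?S (wedge f 1 2)"
    if canonical: "canonical_form \<delta> ?S A B f" for f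
  proof -
    obtain f' where f': "canonical_form \<delta> ?S A B f'" "\<exists>u\<in>?S. wedge f' 1 2 u \<noteq> 0"
      using canonical_with_nonzero_wedge[OF assms(2,5,6,7) canonical] by blast
    moreover have "smooth_forms ?S f'"
      using canonical_imp_describes[OF S f'(1)] by (simp add: pointwise_describes_def)
    ultimately show ?thesis
      using generically_nonzero_wedge_iff[OF S] by blast
  qed
  then show ?thesis
    by (simp only: iff) blast
qed

end
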